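(* Let $\Delta\subset\mathbb{C}^2$ be a closed polydisc with non-empty interior that contains $0$, let $U$ be a bounded open neighborhood of $\Delta$, and set $V=U\setminus\Delta$, with complex coordinates $\zeta_1,\zeta_2$ and real coordinates $x_1,\dots,x_4$ where $\zeta_j=x_{2j-1}+ix_{2j}$. Let $\mathfrak{X}=W^{1,2}(V)\oplus L^2(V)$ and define bounded operators $A_1,A_2,A_3,A_4$ on $\mathfrak{X}$ by \[A_1(f,g)=(\zeta_1 f,\zeta_1 g),\quad A_2(f,g)=(\zeta_2 f,\zeta_2 g),\quad A_3(f,g)=(0,D_{\bar\zeta_1}f),\quad A_4(f,g)=(0,D_{\bar\zeta_2}f).\] Then $A=(A_1,A_2,A_3,A_4)$ is a commuting quadruple, $\mathfrak{X}_1=\ker(A_3)\cap\ker(A_4)$ is a hyperinvariant subspace for $A$, and the Taylor joint spectrum $\sigma_{\mathrm{Ta}}(A|_{\mathfrak{X}_1})$ of the restricted tuple $(A_1|_{\mathfrak{X}_1},\dots,A_4|_{\mathfrak{X}_1})$ is not a subset of $\sigma_{\mathrm{Ta}}(A)$.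
   Context: $L^2(V)$ is taken with respect to Lebesgue measure $\tau$ on $V\subset\mathbb{R}^4$. For $f\in L^2(V)$, $g\in L^2(V)$ is the weak $x_j$-derivative $D_{x_j}f$ of $f$ if $\int_V g\phi\,d\tau=-\int_V f\,\partial\phi/\partial x_j\,d\tau$ for all compactly supported $C^1$ functions $\phi$ on $V$. $W^{1,2}(V)$ is the Hilbert space of $f\in L^2(V)$ for which $D_{x_1}f,\dots,D_{x_4}f$ exist in $L^2(V)$, with norm $\|f\|^2_{W^{1,2}}=\|f\|^2_{L^2}+\sum_{j=1}^4\|D_{x_j}f\|^2_{L^2}$. For $f\in W^{1,2}(V)$, $D_{\bar\zeta_j}f=\tfrac12(D_{x_{2j-1}}f+iD_{x_{2j}}f)$, $j=1,2$. A subspace $\mathfrak{M}$ is hyperinvariant for a commuting tuple $T=(T_1,\dots,T_d)$ if $B\mathfrak{M}\subset\mathfrak{M}$ for every bounded operator $B$ commuting with all $T_i$. $\sigma_{\mathrm{Ta}}$ denotes the Taylor joint spectrum. *)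

theory Defs
  imports "HOL-Analysis.Analysis" "HOL-Library.Function_Algebras" "HOL-Library.Product_Plus"
begin

text \<open>A (quotient) space is given by a carrier C of representatives, a predicate Z
  ("is zero in the quotient"), a scalar multiplication sc and a norm nrm.
  Two representatives x, y are identified iff Z (x - y).\<close>

definition koszul_d ::
  "(complex \<Rightarrow> 'v::ab_group_add \<Rightarrow> 'v) \<Rightarrow> (nat \<Rightarrow> 'v \<Rightarrow> 'v) \<Rightarrow> nat \<Rightarrow> (nat \<Rightarrow> complex)
     \<Rightarrow> (nat set \<Rightarrow> 'v) \<Rightarrow> nat set \<Rightarrow> 'v" where
  "koszul_d sc T n lam \<omega> J =
     (\<Sum>i\<in>{i. i < n \<and> i \<notin> J}.
        (if even (card {j\<in>J. j < i}) then (\<lambda>v. v) else uminus)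
          (T i (\<omega> (insert i J)) - sc (lam i) (\<omega> (insert i J))))"

definition taylor_regular ::
  "(complex \<Rightarrow> 'v::ab_group_add \<Rightarrow> 'v) \<Rightarrow> ('v \<Rightarrow> bool) \<Rightarrow> 'v set \<Rightarrow> (nat \<Rightarrow> 'v \<Rightarrow> 'v) \<Rightarrow> nat
     \<Rightarrow> (nat \<Rightarrow> complex) \<Rightarrow> bool" where
  "taylor_regular sc Z C T n lam \<longleftrightarrow>
     (\<forall>k\<le>n. \<forall>\<omega>::nat set \<Rightarrow> 'v.
        (\<forall>K. K \<subseteq> {..<n} \<and> card K = k \<longrightarrow> \<omega> K \<in> C) \<longrightarrow>
        (k = 0 \<or> (\<forall>J. J \<subseteq> {..<n} \<and> card J = k - 1 \<longrightarrow> Z (koszul_d sc T n lam \<omega> J))) \<longrightarrow>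
        (\<exists>\<eta>. (\<forall>K. K \<subseteq> {..<n} \<and> card K = Suc k \<longrightarrow> \<eta> K \<in> C) \<and>
             (\<forall>J. J \<subseteq> {..<n} \<and> card J = k \<longrightarrow> Z (koszul_d sc T n lam \<eta> J - \<omega> J))))"

definition taylor_spectrum ::
  "(complex \<Rightarrow> 'v::ab_group_add \<Rightarrow> 'v) \<Rightarrow> ('v \<Rightarrow> bool) \<Rightarrow> 'v set \<Rightarrow> (nat \<Rightarrow> 'v \<Rightarrow> 'v) \<Rightarrow> nat
     \<Rightarrow> (nat \<Rightarrow> complex) set" where
  "taylor_spectrum sc Z C T n =
     {lam. (\<forall>i\<ge>n. lam i = 0) \<and> \<not> taylor_regular sc Z C T n lam}"

definition bounded_op ::
  "(complex \<Rightarrow> 'v::ab_group_add \<Rightarrow> 'v) \<Rightarrow> ('v \<Rightarrow> bool) \<Rightarrow> ('v \<Rightarrow> real) \<Rightarrow> 'v set \<Rightarrow> ('v \<Rightarrow> 'v) \<Rightarrow> bool" where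
  "bounded_op sc Z nrm C B \<longleftrightarrow>
     (\<forall>x\<in>C. B x \<in> C) \<and>
     (\<forall>x\<in>C. \<forall>y\<in>C. Z (x - y) \<longrightarrow> Z (B x - B y)) \<and>
     (\<forall>x\<in>C. \<forall>y\<in>C. Z (B (x + y) - (B x + B y))) \<and>
     (\<forall>c. \<forall>x\<in>C. Z (B (sc c x) - sc c (B x))) \<and>
     (\<exists>K. \<forall>x\<in>C. nrm (B x) \<le> K * nrm x)"

definition commuting_tuple ::
  "('v::ab_group_add \<Rightarrow> bool) \<Rightarrow> 'v set \<Rightarrow> (nat \<Rightarrow> 'v \<Rightarrow> 'v) \<Rightarrow> nat \<Rightarrow> bool" where
  "commuting_tuple Z C T n \<longleftrightarrow>
     (\<forall>i<n. \<forall>j<n. \<forall>x\<in>C. Z (T i (T j x) - T j (T i x)))"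

definition hyperinvariant ::
  "(complex \<Rightarrow> 'v::ab_group_add \<Rightarrow> 'v) \<Rightarrow> ('v \<Rightarrow> bool) \<Rightarrow> ('v \<Rightarrow> real) \<Rightarrow> 'v set \<Rightarrow> (nat \<Rightarrow> 'v \<Rightarrow> 'v)
     \<Rightarrow> nat \<Rightarrow> 'v set \<Rightarrow> bool" where
  "hyperinvariant sc Z nrm C T n M \<longleftrightarrow>
     M \<subseteq> C \<and>
     (\<forall>B. bounded_op sc Z nrm C B \<and> (\<forall>i<n. \<forall>x\<in>C. Z (B (T i x) - T i (B x)))
          \<longrightarrow> (\<forall>x\<in>M. B x \<in> M))"

type_synonym pt = "real^4"
type_synonym fn = "pt \<Rightarrow> complex"

definition zeta1 :: "pt \<Rightarrow> complex" where "zeta1 x = Complex (x$1) (x$2)"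
definition zeta2 :: "pt \<Rightarrow> complex" where "zeta2 x = Complex (x$3) (x$4)"

definition polydisc :: "complex \<Rightarrow> complex \<Rightarrow> real \<Rightarrow> real \<Rightarrow> pt set" where
  "polydisc a1 a2 r1 r2 = {x. cmod (zeta1 x - a1) \<le> r1 \<and> cmod (zeta2 x - a2) \<le> r2}"

definition L2 :: "pt set \<Rightarrow> fn \<Rightarrow> bool" where
  "L2 V f \<longleftrightarrow> set_borel_measurable lebesgue V f \<and>
              set_integrable lebesgue V (\<lambda>x. (cmod (f x))\<^sup>2)"

definition L2norm :: "pt set \<Rightarrow> fn \<Rightarrow> real" where
  "L2norm V f = sqrt (set_lebesgue_integral lebesgue V (\<lambda>x. (cmod (f x))\<^sup>2))"

definition test_fun :: "pt set \<Rightarrow> fn \<Rightarrow> bool" where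
  "test_fun V \<phi> \<longleftrightarrow>
     (\<exists>D :: pt \<Rightarrow> (pt \<Rightarrow>\<^sub>L complex).
        (\<forall>x\<in>V. (\<phi> has_derivative blinfun_apply (D x)) (at x)) \<and> continuous_on V D) \<and>
     compact (closure {x\<in>V. \<phi> x \<noteq> 0}) \<and> closure {x\<in>V. \<phi> x \<noteq> 0} \<subseteq> V"

definition partial :: "4 \<Rightarrow> fn \<Rightarrow> fn" where
  "partial j \<phi> x = frechet_derivative \<phi> (at x) (axis j 1)"

definition is_weak_deriv :: "pt set \<Rightarrow> 4 \<Rightarrow> fn \<Rightarrow> fn \<Rightarrow> bool" where
  "is_weak_deriv V j f g \<longleftrightarrow> L2 V g \<and>
     (\<forall>\<phi>. test_fun V \<phi> \<longrightarrow>
        set_lebesgue_integral lebesgue V (\<lambda>x. g x * \<phi> x) =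
          - set_lebesgue_integral lebesgue V (\<lambda>x. f x * partial j \<phi> x))"

definition W12 :: "pt set \<Rightarrow> fn \<Rightarrow> bool" where
  "W12 V f \<longleftrightarrow> L2 V f \<and> (\<forall>j. \<exists>g. is_weak_deriv V j f g)"

definition wd :: "pt set \<Rightarrow> 4 \<Rightarrow> fn \<Rightarrow> fn" where
  "wd V j f = (SOME g. is_weak_deriv V j f g)"

definition W12norm :: "pt set \<Rightarrow> fn \<Rightarrow> real" where
  "W12norm V f = sqrt ((L2norm V f)\<^sup>2 + (\<Sum>j\<in>UNIV. (L2norm V (wd V j f))\<^sup>2))"

definition dzbar :: "pt set \<Rightarrow> nat \<Rightarrow> fn \<Rightarrow> fn" where
  "dzbar V k f = (\<lambda>x. (wd V (of_nat (2*k - 1)) f x + \<i> * wd V (of_nat (2*k)) f x) / 2)"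

type_synonym xel = "fn \<times> fn"

definition Xcar :: "pt set \<Rightarrow> xel set" where
  "Xcar V = {(f, g). W12 V f \<and> L2 V g}"

definition XZ :: "pt set \<Rightarrow> xel \<Rightarrow> bool" where
  "XZ V u \<longleftrightarrow> (AE x in lebesgue. x \<in> V \<longrightarrow> fst u x = 0 \<and> snd u x = 0)"

definition Xnorm :: "pt set \<Rightarrow> xel \<Rightarrow> real" where
  "Xnorm V u = sqrt ((W12norm V (fst u))\<^sup>2 + (L2norm V (snd u))\<^sup>2)"

definition Xsc :: "complex \<Rightarrow> xel \<Rightarrow> xel" where
  "Xsc c u = ((\<lambda>x. c * fst u x), (\<lambda>x. c * snd u x))"

text \<open>Operators A_1, ..., A_4 are indexed 0, ..., 3.\<close>
definition Aop :: "pt set \<Rightarrow> nat \<Rightarrow> xel \<Rightarrow> xel" where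
  "Aop V i u =
     (if i = 0 then ((\<lambda>x. zeta1 x * fst u x), (\<lambda>x. zeta1 x * snd u x))
      else if i = 1 then ((\<lambda>x. zeta2 x * fst u x), (\<lambda>x. zeta2 x * snd u x))
      else if i = 2 then ((\<lambda>x. 0), dzbar V 1 (fst u))
      else ((\<lambda>x. 0), dzbar V 2 (fst u)))"

definition X1car :: "pt set \<Rightarrow> xel set" where
  "X1car V = {u \<in> Xcar V. XZ V (Aop V 2 u) \<and> XZ V (Aop V 3 u)}"

end

theory Submission
  imports Defs
begin

text \<open>
  The point separating the two spectra is $\lambda = (a_1, a_2, 0, 0)$, where $(a_1, a_2)$ is the
  centre of the polydisc (the point $0$ would not do for the argument, since it may lie on the
  boundary). Write $z_j = \zeta_j - a_j$.

  On the closure of $V$ the functions $z_1, z_2$ have no common zero, so the multipliers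
  $g_j = \bar z_j / (|z_1|^2 + |z_2|^2)$ are smooth and $g_1 z_1 + g_2 z_2 = 1$. Hence the Koszul
  complex of the pair $(A_1 - a_1, A_2 - a_2)$ on the whole space is contractible, and appending
  further commuting operators to a tuple with exact Koszul complex keeps it exact; so
  $\lambda \notin \sigma(A)$.

  On the kernel, exactness at the end of the complex would give $1 = z_1 f_1 + z_2 f_2$ with weakly
  holomorphic $f_1, f_2$. Instead of extending $f_j$ to the polydisc by Hartogs' theorem, choose
  radial functions with $P_j' = b_j$ such that $b_j(|z_j|^2)$ lives on an annulus just outside the
  polydisc and $P_j(|z_j|^2)$ vanishes outside it. Then $P_1 b_2$ and $b_1 P_2$ are test functions on
  $V$, and $z_1 b_1 b_2 = \bar\partial_1 (P_1 b_2)$, $z_2 b_1 b_2 = \bar\partial_2 (b_1 P_2)$. Hence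
  $\int b_1 b_2 = \int f_1 \bar\partial_1 (P_1 b_2) + \int f_2 \bar\partial_2 (b_1 P_2) = 0$,
  although $b_1 b_2 \ge 0$ is positive on a nonempty open set.
\<close>

section \<open>Continuously differentiable functions and test functions\<close>

text \<open>The multipliers g_j are not holomorphic, so multiplication by them neither commutes with
  A_3 and A_4 nor preserves X_1. The first fact confines the contraction to the pair formed from A_1
  and A_2; exactness then passes to the quadruple by a mapping cone. The second fact is what lets
  the spectrum grow under restriction. A_3 and A_4 read the first summand and write into the second,
  so their products vanish and second weak derivatives never occur. \<open>wd\<close> selects a weak
  derivative by choice, so the operators are additive and commute only up to null sets. All
  homological algebra is therefore carried out on representatives modulo null elements, and it rests
  on the almost everywhere uniqueness of weak derivatives.\<close>

definition C1_on :: "'a::real_normed_vector set \<Rightarrow> ('a \<Rightarrow> 'b::real_normed_vector) \<Rightarrow> bool" where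
  "C1_on S f \<longleftrightarrow>
     (\<exists>D. (\<forall>x\<in>S. (f has_derivative blinfun_apply (D x)) (at x)) \<and> continuous_on S D)"

lemma C1_onI:
  assumes "\<And>x. x \<in> S \<Longrightarrow> (f has_derivative blinfun_apply (D x)) (at x)" "continuous_on S D"
  shows "C1_on S f"
  using assms unfolding C1_on_def by (intro exI[of _ D]) auto

lemma C1_on_subset: "C1_on S f \<Longrightarrow> T \<subseteq> S \<Longrightarrow> C1_on T f"
  unfolding C1_on_def by (meson continuous_on_subset subsetD)

lemma C1_on_imp_continuous_on: "C1_on S f \<Longrightarrow> continuous_on S f"
  unfolding C1_on_def
  by (meson continuous_at_imp_continuous_on has_derivative_continuous)

lemma C1_on_bounded_linear:
  assumes "bounded_linear f" shows "C1_on S f"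
proof -
  have "(f has_derivative blinfun_apply (Blinfun f)) (at x)" for x
    using assms by (simp add: bounded_linear_Blinfun_apply bounded_linear_imp_has_derivative)
  then show ?thesis unfolding C1_on_def by (intro exI[of _ "\<lambda>_. Blinfun f"]) auto
qed

lemma C1_on_const [simp]: "C1_on S (\<lambda>_. c)"
  unfolding C1_on_def by (rule exI[of _ "\<lambda>_. 0"]) (auto simp: zero_blinfun.rep_eq)

lemma C1_on_add:
  assumes "C1_on S f" "C1_on S g" shows "C1_on S (\<lambda>x. f x + g x)"
proof -
  obtain D where "\<forall>x\<in>S. (f has_derivative blinfun_apply (D x)) (at x)" "continuous_on S D"
    using assms(1) unfolding C1_on_def by blast
  moreover obtain E where "\<forall>x\<in>S. (g has_derivative blinfun_apply (E x)) (at x)" "continuous_on S E"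
    using assms(2) unfolding C1_on_def by blast
  ultimately show ?thesis unfolding C1_on_def
    by (intro exI[of _ "\<lambda>x. D x + E x"])
      (auto intro!: derivative_eq_intros continuous_intros simp: blinfun.add_left)
qed

lemma C1_on_mult:
  fixes f g :: "'a::real_normed_vector \<Rightarrow> 'b::real_normed_algebra"
  assumes "C1_on S f" "C1_on S g" shows "C1_on S (\<lambda>x. f x * g x)"
proof -
  obtain D where D: "\<forall>x\<in>S. (f has_derivative blinfun_apply (D x)) (at x)" "continuous_on S D"
    using assms(1) unfolding C1_on_def by blast
  obtain E where E: "\<forall>x\<in>S. (g has_derivative blinfun_apply (E x)) (at x)" "continuous_on S E"
    using assms(2) unfolding C1_on_def by blast
  let ?F = "\<lambda>x. (blinfun_mult_right (f x) o\<^sub>L E x) + (blinfun_mult_left (g x) o\<^sub>L D x)"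
  have "((\<lambda>x. f x * g x) has_derivative blinfun_apply (?F x)) (at x)" if "x \<in> S" for x
    by (rule has_derivative_eq_rhs[OF has_derivative_mult[OF bspec[OF D(1) that] bspec[OF E(1) that]]])
      (simp add: fun_eq_iff plus_blinfun.rep_eq)
  moreover have "continuous_on S ?F"
    using bounded_bilinear.continuous_on[OF bounded_bilinear_blinfun_compose
        bounded_linear.continuous_on[OF bounded_linear_blinfun_mult_right C1_on_imp_continuous_on[OF assms(1)]] E(2)]
      bounded_bilinear.continuous_on[OF bounded_bilinear_blinfun_compose
        bounded_linear.continuous_on[OF bounded_linear_blinfun_mult_left C1_on_imp_continuous_on[OF assms(2)]] D(2)]
    by (rule continuous_on_add)
  ultimately show ?thesis by (rule C1_onI)
qed

lemma C1_on_bounded_linear_compose: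
  assumes "bounded_linear L" "C1_on S f" shows "C1_on S (\<lambda>x. L (f x))"
proof -
  obtain D where D: "\<forall>x\<in>S. (f has_derivative blinfun_apply (D x)) (at x)" "continuous_on S D"
    using assms(2) unfolding C1_on_def by blast
  have "((\<lambda>x. L (f x)) has_derivative blinfun_apply (Blinfun L o\<^sub>L D x)) (at x)" if "x \<in> S" for x
    by (rule has_derivative_eq_rhs[OF bounded_linear.has_derivative[OF assms(1) bspec[OF D(1) that]]])
      (simp add: fun_eq_iff bounded_linear_Blinfun_apply[OF assms(1)])
  moreover have "continuous_on S (\<lambda>x. Blinfun L o\<^sub>L D x)"
    by (rule bounded_bilinear.continuous_on[OF bounded_bilinear_blinfun_compose continuous_on_const D(2)])
  ultimately show ?thesis by (rule C1_onI)
qed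

text \<open>Regularity of \<open>F\<close> is required only on the range of \<open>g\<close>, so
  \<open>inverse\<close> qualifies whenever \<open>g\<close> has no zero on
  \<open>S\<close>.\<close>

lemma C1_on_real_compose:
  fixes F :: "real \<Rightarrow> real"
  assumes g: "C1_on S g" and F: "\<And>x. x \<in> S \<Longrightarrow> (F has_real_derivative F' (g x)) (at (g x))"
    and F': "continuous_on (g ` S) F'"
  shows "C1_on S (\<lambda>x. F (g x))"
proof -
  obtain D where D: "\<forall>x\<in>S. (g has_derivative blinfun_apply (D x)) (at x)" "continuous_on S D"
    using g unfolding C1_on_def by blast
  have "((\<lambda>x. F (g x)) has_derivative blinfun_apply (F' (g x) *\<^sub>R D x)) (at x)" if "x \<in> S" for x
    by (rule has_derivative_eq_rhs[OF has_derivative_compose[OF bspec[OF D(1) that]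
            F[OF that, unfolded has_field_derivative_def]]]) (simp add: fun_eq_iff scaleR_blinfun.rep_eq)
  moreover have "continuous_on S (\<lambda>x. F' (g x) *\<^sub>R D x)"
    by (intro continuous_on_scaleR D continuous_on_compose2[OF F' C1_on_imp_continuous_on[OF g]]) auto
  ultimately show ?thesis by (rule C1_onI)
qed

lemma C1_on_of_real: "C1_on S f \<Longrightarrow> C1_on S (\<lambda>x. complex_of_real (f x))"
  using C1_on_bounded_linear_compose bounded_linear_of_real by blast

lemma C1_on_prod:
  fixes f :: "'i \<Rightarrow> 'a::real_normed_vector \<Rightarrow> real"
  assumes "\<And>i. i \<in> I \<Longrightarrow> C1_on S (f i)"
  shows "C1_on S (\<lambda>x. \<Prod>i\<in>I. f i x)"
  using assms by (induction I rule: infinite_finite_induct) (auto intro: C1_on_mult)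

lemma C1_on_nth: "C1_on S (\<lambda>x::real^'n. x $ i)"
  by (intro C1_on_bounded_linear bounded_linear_vec_nth)

lemma C1_on_diff:
  assumes "C1_on S f" "C1_on S g" shows "C1_on S (\<lambda>x. f x - g x)"
  using C1_on_add[OF assms(1) C1_on_bounded_linear_compose[OF bounded_linear_minus[OF bounded_linear_ident] assms(2)]]
  by simp

lemma partial_eq:
  assumes "(f has_derivative D) (at x)" shows "partial j f x = D (axis j 1)"
  unfolding partial_def using frechet_derivative_at[OF assms] by simp

text \<open>\<open>C1_on\<close> uses the derivative \<open>at x\<close>, not within
  \<open>S\<close>, so \<open>S\<close> may be a compact set such as \<open>closure V\<close>.
  Continuity of the partial derivatives then bounds them there.\<close>

lemma C1_on_continuous_partial:
  assumes "C1_on S f" shows "continuous_on S (partial j f)"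
proof -
  obtain D where D: "\<forall>x\<in>S. (f has_derivative blinfun_apply (D x)) (at x)" "continuous_on S D"
    using assms unfolding C1_on_def by blast
  have "continuous_on S (\<lambda>x. blinfun_apply (D x) (axis j 1))"
    by (intro continuous_intros D)
  then show ?thesis
    by (rule continuous_on_eq) (simp add: partial_eq[OF bspec[OF D(1)]])
qed

lemma C1_on_has_partial:
  assumes "C1_on S f" "x \<in> S"
  shows "(f has_derivative frechet_derivative f (at x)) (at x)"
  using assms unfolding C1_on_def by (meson differentiableI frechet_derivative_works)

lemma partial_mult:
  assumes "C1_on S f" "C1_on S g" "x \<in> S"
  shows "partial j (\<lambda>x. f x * g x) x = f x * partial j g x + partial j f x * g x"
  using has_derivative_mult[OF C1_on_has_partial[OF assms(1,3)] C1_on_has_partial[OF assms(2,3)]]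
  by (subst partial_eq) (auto simp: partial_def)

lemma test_fun_iff: "test_fun V \<phi> \<longleftrightarrow> C1_on V \<phi> \<and> compact (closure {x\<in>V. \<phi> x \<noteq> 0}) \<and>
    closure {x\<in>V. \<phi> x \<noteq> 0} \<subseteq> V"
  unfolding test_fun_def C1_on_def by blast

lemma test_funI:
  assumes "C1_on V \<phi>" "compact K" "K \<subseteq> V" "\<And>x. x \<in> V \<Longrightarrow> \<phi> x \<noteq> 0 \<Longrightarrow> x \<in> K"
  shows "test_fun V \<phi>"
proof -
  have "{x\<in>V. \<phi> x \<noteq> 0} \<subseteq> K" using assms by auto
  then have "closure {x\<in>V. \<phi> x \<noteq> 0} \<subseteq> K"
    by (simp add: assms(2) closure_minimal compact_imp_closed)
  then show ?thesis unfolding test_fun_iff using assms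
    by (meson closed_closure compact_Int_closed compact_closure bounded_subset compact_imp_bounded closure_subset subset_trans)
qed

lemma test_fun_mult:
  assumes "C1_on V h" "test_fun V \<phi>" shows "test_fun V (\<lambda>x. h x * \<phi> x)"
  using assms C1_on_mult
  by (intro test_funI[where K = "closure {x\<in>V. \<phi> x \<noteq> 0}"])
    (auto simp: test_fun_iff intro: subsetD[OF closure_subset])

text \<open>Off its closed support a test function vanishes on an open set, so its partial
  derivatives vanish there as well. Nothing is claimed outside \<open>V\<close>, where the values of
  a test function are arbitrary.\<close>

lemma test_fun_supportE:
  assumes "test_fun V \<phi>" "open V"
  obtains K where "compact K" "K \<subseteq> V"
    "\<And>x. x \<in> V - K \<Longrightarrow> \<phi> x = 0" "\<And>x j. x \<in> V - K \<Longrightarrow> partial j \<phi> x = 0"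
proof
  let ?K = "closure {x\<in>V. \<phi> x \<noteq> 0}"
  show "compact ?K" "?K \<subseteq> V" using assms by (auto simp: test_fun_iff)
  show 0: "\<phi> x = 0" if "x \<in> V - ?K" for x
    using that closure_subset[of "{x\<in>V. \<phi> x \<noteq> 0}"] by auto
  show "partial j \<phi> x = 0" if "x \<in> V - ?K" for x j
  proof -
    have "open (V - ?K)" using assms(2) by (simp add: open_Diff)
    then have "(\<phi> has_derivative (\<lambda>_. 0)) (at x)"
      by (rule has_derivative_transform_within_open[OF has_derivative_const[where c=0] _ that]) (rule 0[symmetric])
    from partial_eq[OF this] show ?thesis by simp
  qed
qed

section \<open>Square-integrable functions on a bounded open set\<close>

lemma L2norm_sq: "(L2norm V f)\<^sup>2 = set_lebesgue_integral lebesgue V (\<lambda>x. (cmod (f x))\<^sup>2)"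
proof -
  have "0 \<le> set_lebesgue_integral lebesgue V (\<lambda>x. (cmod (f x))\<^sup>2)"
    unfolding set_lebesgue_integral_def by (intro Bochner_Integration.integral_nonneg) auto
  then show ?thesis by (simp add: L2norm_def)
qed

lemma norm_add_sq_le: "(norm (a + b))\<^sup>2 \<le> 2 * (norm a)\<^sup>2 + 2 * (norm b)\<^sup>2" for a b :: "'a::real_normed_vector"
proof -
  have "(norm (a + b))\<^sup>2 \<le> (norm a + norm b)\<^sup>2" by (intro power_mono norm_triangle_ineq) auto
  also have "\<dots> \<le> 2 * (norm a)\<^sup>2 + 2 * (norm b)\<^sup>2" using sum_squares_bound[of "norm a" "norm b"]
    by (simp add: power2_sum)
  finally show ?thesis .
qed

locale bounded_open =
  fixes V :: "pt set"
  assumes opn: "open V" and bdd: "bounded V"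
begin

lemma sets_V [measurable, simp]: "V \<in> sets lebesgue" "V \<in> sets borel"
  using borel_open[OF opn] by (simp_all add: sets_completionI_sets)

lemma emeasure_V: "emeasure lebesgue V < \<infinity>"
  using emeasure_bounded_finite[OF bdd] by simp

lemma set_borel_measurable_cont:
  fixes h :: "pt \<Rightarrow> 'b::{second_countable_topology, real_normed_vector}"
  assumes "continuous_on V h" shows "set_borel_measurable lebesgue V h"
proof -
  have "(\<lambda>x. indicator V x *\<^sub>R h x) \<in> borel_measurable borel"
    using assms by (intro borel_measurable_continuous_on_indicator) auto
  then show ?thesis unfolding set_borel_measurable_def
    by (intro measurable_completion) simp
qed

lemma set_borel_measurable_mult:
  fixes f g :: fn
  assumes "set_borel_measurable lebesgue V f" "set_borel_measurable lebesgue V g"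
  shows "set_borel_measurable lebesgue V (\<lambda>x. f x * g x)"
proof -
  have "(\<lambda>x. (indicator V x *\<^sub>R f x) * (indicator V x *\<^sub>R g x)) \<in> borel_measurable lebesgue"
    using assms unfolding set_borel_measurable_def by (intro borel_measurable_times)
  also have "(\<lambda>x. (indicator V x *\<^sub>R f x) * (indicator V x *\<^sub>R g x)) = (\<lambda>x. indicator V x *\<^sub>R (f x * g x))"
    by (auto simp: indicator_def)
  finally show ?thesis unfolding set_borel_measurable_def .
qed

lemma set_integrable_bounded_by:
  fixes f :: "pt \<Rightarrow> 'b::{banach, second_countable_topology}" and g :: "pt \<Rightarrow> real"
  assumes "set_integrable lebesgue V g" "set_borel_measurable lebesgue V f"
    "\<And>x. x \<in> V \<Longrightarrow> norm (f x) \<le> g x"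
  shows "set_integrable lebesgue V f"
  using assms(1) unfolding set_integrable_def
  by (rule Bochner_Integration.integrable_bound)
    (use assms in \<open>auto simp: set_borel_measurable_def indicator_def intro!: AE_I2 order_trans[OF _ abs_ge_self]\<close>)

lemma set_integrable_const: "set_integrable lebesgue V (\<lambda>_. c::real)"
  using emeasure_V unfolding set_integrable_def
  by (intro integrable_scaleR_left integrable_real_indicator) auto

lemma set_borel_measurable_norm_sq:
  fixes f :: fn
  assumes "set_borel_measurable lebesgue V f" shows "set_borel_measurable lebesgue V (\<lambda>x. (cmod (f x))\<^sup>2)"
proof -
  have "(\<lambda>x. (cmod (indicator V x *\<^sub>R f x))\<^sup>2) \<in> borel_measurable lebesgue"
    using assms unfolding set_borel_measurable_def by measurable
  also have "(\<lambda>x. (cmod (indicator V x *\<^sub>R f x))\<^sup>2) = (\<lambda>x. indicator V x *\<^sub>R (cmod (f x))\<^sup>2)"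
    by (auto simp: indicator_def)
  finally show ?thesis unfolding set_borel_measurable_def .
qed

lemma L2_bound:
  assumes "set_borel_measurable lebesgue V f" "set_integrable lebesgue V g"
    "\<And>x. x \<in> V \<Longrightarrow> (cmod (f x))\<^sup>2 \<le> g x"
  shows "L2 V f" "(L2norm V f)\<^sup>2 \<le> set_lebesgue_integral lebesgue V g"
proof -
  have i: "set_integrable lebesgue V (\<lambda>x. (cmod (f x))\<^sup>2)"
    using assms(2) set_borel_measurable_norm_sq[OF assms(1)]
    by (rule set_integrable_bounded_by) (simp add: assms(3))
  show "L2 V f" using i assms(1) by (simp add: L2_def)
  show "(L2norm V f)\<^sup>2 \<le> set_lebesgue_integral lebesgue V g"
    unfolding L2norm_sq using i assms(2) by (rule set_integral_mono) (rule assms(3))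
qed

lemma L2_mult:
  assumes "L2 V f" "continuous_on V h" "\<And>x. x \<in> V \<Longrightarrow> cmod (h x) \<le> M"
  shows "L2 V (\<lambda>x. h x * f x)" "(L2norm V (\<lambda>x. h x * f x))\<^sup>2 \<le> M\<^sup>2 * (L2norm V f)\<^sup>2"
proof -
  have "set_borel_measurable lebesgue V (\<lambda>x. h x * f x)"
    using assms by (intro set_borel_measurable_mult set_borel_measurable_cont[OF assms(2)]) (auto simp: L2_def)
  moreover have "set_integrable lebesgue V (\<lambda>x. M\<^sup>2 * (cmod (f x))\<^sup>2)"
    using assms by (auto simp: L2_def intro: set_integrable_mult_right)
  moreover have "(cmod (h x * f x))\<^sup>2 \<le> M\<^sup>2 * (cmod (f x))\<^sup>2" if "x \<in> V" for x
    using assms(3)[OF that] by (simp add: norm_mult power_mult_distrib mult_right_mono power_mono)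
  ultimately show "L2 V (\<lambda>x. h x * f x)" "(L2norm V (\<lambda>x. h x * f x))\<^sup>2 \<le> M\<^sup>2 * (L2norm V f)\<^sup>2"
    using L2_bound[of "\<lambda>x. h x * f x" "\<lambda>x. M\<^sup>2 * (cmod (f x))\<^sup>2"] by (auto simp: L2norm_sq)
qed

text \<open>The crude bound with factor 2 stands in for Minkowski's inequality: the operators have
  to be bounded, but the constants do not matter.\<close>

lemma L2_add:
  assumes "L2 V f" "L2 V g"
  shows "L2 V (\<lambda>x. f x + g x)"
    "(L2norm V (\<lambda>x. f x + g x))\<^sup>2 \<le> 2 * (L2norm V f)\<^sup>2 + 2 * (L2norm V g)\<^sup>2"
proof -
  let ?b = "\<lambda>x. 2 * (cmod (f x))\<^sup>2 + 2 * (cmod (g x))\<^sup>2"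
  have m: "set_borel_measurable lebesgue V (\<lambda>x. f x + g x)"
    using assms borel_measurable_add[of "\<lambda>x. indicator V x *\<^sub>R f x" lebesgue "\<lambda>x. indicator V x *\<^sub>R g x"]
    unfolding L2_def set_borel_measurable_def by (simp add: scaleR_add_right)
  have i: "set_integrable lebesgue V (\<lambda>x. 2 * (cmod (f x))\<^sup>2)" "set_integrable lebesgue V (\<lambda>x. 2 * (cmod (g x))\<^sup>2)"
    using assms by (auto simp: L2_def)
  show "L2 V (\<lambda>x. f x + g x)"
    "(L2norm V (\<lambda>x. f x + g x))\<^sup>2 \<le> 2 * (L2norm V f)\<^sup>2 + 2 * (L2norm V g)\<^sup>2"
    using L2_bound[OF m set_integral_add(1)[OF i] norm_add_sq_le] i by (auto simp: L2norm_sq)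
qed

lemma L2_cont:
  assumes "continuous_on V h" "\<And>x. x \<in> V \<Longrightarrow> cmod (h x) \<le> M"
  shows "L2 V h"
  using assms by (intro L2_bound(1)[where g="\<lambda>_. M\<^sup>2"] set_borel_measurable_cont set_integrable_const power_mono) auto

text \<open>\<open>V\<close> has finite measure, so t <= 1 + t^2 provides an integrable
  majorant.\<close>

lemma set_integrable_L2:
  assumes "L2 V f" shows "set_integrable lebesgue V f"
proof (rule set_integrable_bounded_by)
  show "set_integrable lebesgue V (\<lambda>x. 1 + (cmod (f x))\<^sup>2)"
    using assms set_integrable_const by (intro set_integral_add) (auto simp: L2_def)
  show "set_borel_measurable lebesgue V f" using assms by (simp add: L2_def)
  have "t \<le> 1 + t\<^sup>2" for t :: real
    using sum_squares_bound[of 1 t] by (smt (verit) zero_le_power2 mult.commute one_power2 power2_eq_square mult_le_cancel_left1)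
  then show "norm (f x) \<le> 1 + (cmod (f x))\<^sup>2" for x by simp
qed

lemma L2_cong_AE:
  assumes "L2 V f" "L2 V g" "AE x in lebesgue. x \<in> V \<longrightarrow> f x = g x"
  shows "L2norm V f = L2norm V g"
proof -
  have "set_lebesgue_integral lebesgue V (\<lambda>x. (cmod (f x))\<^sup>2) = set_lebesgue_integral lebesgue V (\<lambda>x. (cmod (g x))\<^sup>2)"
    unfolding set_lebesgue_integral_def
    using assms set_borel_measurable_norm_sq unfolding L2_def set_borel_measurable_def
    by (intro integral_cong_AE) (auto simp: indicator_def elim!: eventually_mono)
  then show ?thesis by (simp add: L2norm_def)
qed

lemma test_fun_bounded:
  assumes "test_fun V \<phi>"
  obtains M where "\<And>x. x \<in> V \<Longrightarrow> cmod (\<phi> x) \<le> M" "\<And>x j. x \<in> V \<Longrightarrow> cmod (partial j \<phi> x) \<le> M"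
proof -
  obtain K where K: "compact K" "K \<subseteq> V"
    "\<And>x. x \<in> V - K \<Longrightarrow> \<phi> x = 0" "\<And>x j. x \<in> V - K \<Longrightarrow> partial j \<phi> x = 0"
    using test_fun_supportE[OF assms opn] by blast
  have c: "C1_on K \<phi>" using assms K(2) C1_on_subset by (auto simp: test_fun_iff)
  have "bounded (\<phi> ` K)"
    using K(1) c by (intro compact_imp_bounded compact_continuous_image C1_on_imp_continuous_on)
  then obtain A where A: "\<And>x. x \<in> K \<Longrightarrow> cmod (\<phi> x) \<le> A" unfolding bounded_iff by auto
  have "\<exists>B. \<forall>x\<in>K. cmod (partial j \<phi> x) \<le> B" for j
    using compact_imp_bounded[OF compact_continuous_image[OF C1_on_continuous_partial[OF c] K(1)]]
    unfolding bounded_iff by auto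
  then obtain B where B: "\<And>j x. x \<in> K \<Longrightarrow> cmod (partial j \<phi> x) \<le> B j" by metis
  \<comment> \<open>A single constant that dominates the bound of the values and the bounds of all
    four partial derivatives.\<close>
  let ?M = "\<bar>A\<bar> + (\<Sum>j\<in>UNIV. \<bar>B j\<bar>)"
  have s: "\<bar>B j\<bar> \<le> (\<Sum>j\<in>UNIV. \<bar>B j\<bar>)" for j by (intro member_le_sum) auto
  have s0: "0 \<le> (\<Sum>j\<in>UNIV. \<bar>B j\<bar>)" by (intro sum_nonneg) auto
  show thesis
  proof (rule that[of ?M])
    show "cmod (\<phi> x) \<le> ?M" if "x \<in> V" for x
    proof (cases "x \<in> K")
      case True
      then show ?thesis using A[of x] s0 by linarith
    qed (use K(3)[of x] that s0 in auto)
    show "cmod (partial j \<phi> x) \<le> ?M" if "x \<in> V" for x j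
    proof (cases "x \<in> K")
      case True
      then show ?thesis using B[of x j] s[of j] by linarith
    qed (use K(4)[of x j] that s0 in auto)
  qed
qed

lemma test_fun_continuous:
  assumes "test_fun V \<phi>" shows "continuous_on V \<phi>" "continuous_on V (partial j \<phi>)"
  using assms C1_on_imp_continuous_on C1_on_continuous_partial by (auto simp: test_fun_iff)

lemma set_integrable_test:
  assumes "L2 V f" "test_fun V \<phi>"
  shows "set_integrable lebesgue V (\<lambda>x. f x * \<phi> x)"
    "set_integrable lebesgue V (\<lambda>x. f x * partial j \<phi> x)"
proof -
  obtain M where "\<And>x. x \<in> V \<Longrightarrow> cmod (\<phi> x) \<le> M" "\<And>x j. x \<in> V \<Longrightarrow> cmod (partial j \<phi> x) \<le> M"
    using test_fun_bounded[OF assms(2)] by blast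
  then have "L2 V (\<lambda>x. \<phi> x * f x)" "L2 V (\<lambda>x. partial j \<phi> x * f x)"
    using assms test_fun_continuous by (auto intro!: L2_mult(1))
  then show "set_integrable lebesgue V (\<lambda>x. f x * \<phi> x)"
    "set_integrable lebesgue V (\<lambda>x. f x * partial j \<phi> x)"
    by (auto simp: mult.commute dest: set_integrable_L2)
qed

section \<open>Calculus of weak derivatives: sums and the Leibniz rule\<close>

lemma is_weak_deriv_add:
  assumes "L2 V f" "L2 V f'" "is_weak_deriv V j f g" "is_weak_deriv V j f' g'"
  shows "is_weak_deriv V j (\<lambda>x. f x + f' x) (\<lambda>x. g x + g' x)"
proof -
  have "L2 V g" "L2 V g'" using assms by (auto simp: is_weak_deriv_def)
  then show ?thesis
    using assms set_integrable_test unfolding is_weak_deriv_def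
    by (auto simp: distrib_right set_integral_add L2_add)
qed

text \<open>Test functions are only C^1, so \<open>h\<close> times a test function is again one.
  Testing \<open>g\<close> against this product and expanding its partial derivative classically
  moves the term with \<open>partial j h\<close> over to \<open>f\<close>.\<close>

lemma is_weak_deriv_mult:
  assumes "L2 V f" "is_weak_deriv V j f g" "C1_on V h"
    "\<And>x. x \<in> V \<Longrightarrow> cmod (h x) \<le> M" "\<And>x. x \<in> V \<Longrightarrow> cmod (partial j h x) \<le> M"
  shows "is_weak_deriv V j (\<lambda>x. h x * f x) (\<lambda>x. h x * g x + partial j h x * f x)"
proof -
  have g: "L2 V g" using assms by (auto simp: is_weak_deriv_def)
  have L: "L2 V (\<lambda>x. h x * g x)" "L2 V (\<lambda>x. partial j h x * f x)" "L2 V (\<lambda>x. h x * f x)"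
    using assms g C1_on_imp_continuous_on C1_on_continuous_partial by (auto intro!: L2_mult(1))
  have "(LINT x:V|lebesgue. (h x * g x + partial j h x * f x) * \<phi> x) =
      - (LINT x:V|lebesgue. (h x * f x) * partial j \<phi> x)" if \<phi>: "test_fun V \<phi>" for \<phi>
  proof -
    have "(LINT x:V|lebesgue. g x * (h x * \<phi> x)) = - (LINT x:V|lebesgue. f x * partial j (\<lambda>x. h x * \<phi> x) x)"
      using assms test_fun_mult[OF assms(3) \<phi>] by (auto simp: is_weak_deriv_def)
    also have "(LINT x:V|lebesgue. f x * partial j (\<lambda>x. h x * \<phi> x) x) =
       (LINT x:V|lebesgue. (h x * f x) * partial j \<phi> x + (partial j h x * f x) * \<phi> x)"
      using assms \<phi> by (intro set_lebesgue_integral_cong)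
        (auto simp: partial_mult test_fun_iff algebra_simps)
    also have "\<dots> = (LINT x:V|lebesgue. (h x * f x) * partial j \<phi> x)
        + (LINT x:V|lebesgue. (partial j h x * f x) * \<phi> x)"
      using L \<phi> set_integrable_test by (intro set_integral_add) auto
    finally have "(LINT x:V|lebesgue. (h x * g x) * \<phi> x) = - (LINT x:V|lebesgue. (h x * f x) * partial j \<phi> x)
        - (LINT x:V|lebesgue. (partial j h x * f x) * \<phi> x)"
      by (simp add: mult_ac)
    then show ?thesis
      using L \<phi> set_integrable_test by (simp add: distrib_right set_integral_add)
  qed
  then show ?thesis unfolding is_weak_deriv_def using L L2_add by blast
qed

end

section \<open>Uniqueness of weak derivatives\<close>

lemma sigma_finite_lebesgue: "sigma_finite_measure (lebesgue :: 'a::euclidean_space measure)"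
proof
  obtain A :: "'a set set" where "countable A" "A \<subseteq> sets lborel" "\<Union>A = space lborel"
      "\<forall>a\<in>A. emeasure lborel a \<noteq> \<infinity>"
    using lborel.sigma_finite_countable by blast
  then show "\<exists>A. countable A \<and> A \<subseteq> sets lebesgue \<and> \<Union>A = space (lebesgue :: 'a measure) \<and>
      (\<forall>a\<in>A. emeasure lebesgue a \<noteq> \<infinity>)"
    by (intro exI[of _ A]) (auto simp: subset_iff sets_completionI_sets)
qed

text \<open>Boxes are stable under intersection and generate the Borel sets, so Dynkin's theorem
  carries the vanishing from boxes to Borel sets. Lebesgue sets differ from these by null sets, and
  a function with zero integral over every measurable set is zero almost everywhere.\<close>

lemma AE_zero_if_box_integrals_zero:
  fixes G :: "'a::euclidean_space \<Rightarrow> 'b::{banach, second_countable_topology}"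
  assumes G: "integrable lebesgue G" and box: "\<And>a b. set_lebesgue_integral lebesgue (box a b) G = 0"
  shows "AE x in lebesgue. G x = 0"
proof (rule sigma_finite_measure.density_zero[OF _ G])
  show "sigma_finite_measure (lebesgue :: 'a measure)" by (rule sigma_finite_lebesgue)
  let ?E = "range (\<lambda>(a, b). box a b :: 'a set)"
  have si: "set_integrable lebesgue A G" if "A \<in> sets lebesgue" for A
    using G that unfolding set_integrable_def by (rule integrable_mult_indicator[rotated])
  have UN: "set_lebesgue_integral lebesgue (\<Union>i. A i) G = 0"
    if d: "disjoint_family A" and A: "\<And>i::nat. A i \<in> sets lebesgue"
      and z: "\<And>i. set_lebesgue_integral lebesgue (A i) G = 0" for A :: "nat \<Rightarrow> 'a set"
  proof -
    have "(LINT x:(\<Union>i. A i)|lebesgue. G x) = (\<Sum>i. (LINT x:A i|lebesgue. G x))"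
      using d A si by (intro lebesgue_integral_countable_add) (auto simp: disjoint_family_on_def)
    then show ?thesis by (simp add: z)
  qed
  \<comment> \<open>The complement step of the Dynkin induction needs the integral over the whole
    space, which is no box but an increasing union of boxes.\<close>
  have inc: "set_lebesgue_integral lebesgue (\<Union>i. box (- (real i *\<^sub>R One)) (real i *\<^sub>R One)) G = 0"
  proof -
    have "(\<lambda>i. set_lebesgue_integral lebesgue (box (- (real i *\<^sub>R One)) (real i *\<^sub>R One)) G)
       \<longlonglongrightarrow> set_lebesgue_integral lebesgue (\<Union>i. box (- (real i *\<^sub>R One)) (real i *\<^sub>R One)) G"
      by (rule set_integral_cont_up) (auto simp: incseq_def intro!: si subset_box_imp mult_right_mono)
    then show ?thesis unfolding box using LIMSEQ_unique tendsto_const by blast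
  qed
  have UNIV: "set_lebesgue_integral lebesgue UNIV G = 0"
    using inc unfolding UN_box_eq_UNIV .
  have borel: "set_lebesgue_integral lebesgue A G = 0" if "A \<in> sets borel" for A
  proof -
    have sig: "B \<in> sets lebesgue" if "B \<in> sigma_sets UNIV ?E" for B
    proof -
      have "B \<in> sets borel" using that unfolding borel_eq_box by simp
      then show ?thesis by simp
    qed
    have "A \<in> sigma_sets UNIV ?E" using that by (simp add: borel_eq_box)
    show ?thesis
    proof (rule sigma_sets_induct_disjoint[where P = "\<lambda>A. set_lebesgue_integral lebesgue A G = 0",
          OF _ _ \<open>A \<in> sigma_sets UNIV ?E\<close>])
      show "Int_stable ?E" by (auto simp: Int_stable_def box_Int_box)
    next
      fix A assume A: "A \<in> sigma_sets UNIV ?E" "set_lebesgue_integral lebesgue A G = 0"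
      have "set_lebesgue_integral lebesgue (A \<union> (UNIV - A)) G
        = set_lebesgue_integral lebesgue A G + set_lebesgue_integral lebesgue (UNIV - A) G"
        using sig[OF A(1)] by (intro set_integral_Un si) auto
      then show "set_lebesgue_integral lebesgue (UNIV - A) G = 0" using A(2) UNIV by simp
    next
      fix A :: "nat \<Rightarrow> 'a set"
      assume "disjoint_family A" "range A \<subseteq> sigma_sets UNIV ?E" "\<And>i. set_lebesgue_integral lebesgue (A i) G = 0"
      then show "set_lebesgue_integral lebesgue (\<Union>i. A i) G = 0" using sig by (intro UN) auto
    qed (use box in \<open>auto simp: set_lebesgue_integral_def\<close>)
  qed
  fix A :: "'a set" assume "A \<in> sets lebesgue"
  \<comment> \<open>Lebesgue measure is the completion of \<open>lborel\<close>, so \<open>A\<close>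
    is a Borel set up to a subset of a Borel null set.\<close>
  then obtain B N N' where B: "A = B \<union> N" "N \<subseteq> N'" "N' \<in> null_sets lborel" "B \<in> sets lborel"
    by (auto elim!: completionE[of A lborel] simp: sets_completion)
  have "AE x in lebesgue. x \<notin> N'" using B(3) by (intro AE_not_in) (simp add: null_sets_completionI)
  then have "AE x in lebesgue. x \<in> B \<longleftrightarrow> x \<in> A" by (rule eventually_mono) (use B(1,2) in auto)
  moreover have "set_borel_measurable lebesgue S G" if "S \<in> sets lebesgue" for S
    using si[OF that] unfolding set_integrable_def set_borel_measurable_def by (rule borel_measurable_integrable)
  ultimately have "set_lebesgue_integral lebesgue A G = set_lebesgue_integral lebesgue B G"
    using B(4) \<open>A \<in> sets lebesgue\<close> by (intro set_integral_cong_set) (auto simp: sets_completionI_sets)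
  then show "set_lebesgue_integral lebesgue A G = 0" using borel B(4) by simp
qed

section \<open>Continuously differentiable bumps on boxes\<close>

definition box_bump :: "real^'n \<Rightarrow> real^'n \<Rightarrow> real^'n \<Rightarrow> real" where
  "box_bump a b x = (\<Prod>i\<in>UNIV. (max 0 (x $ i - a $ i))\<^sup>2 * (max 0 (b $ i - x $ i))\<^sup>2)"

text \<open>At the corner t = 0 the difference quotient is at most
  \<open>(max 0 h) ^ (n - 1)\<close>, which tends to 0 because n is at least 2. This is why
  \<open>box_bump\<close> is built from squares and the radial bumps below from squares and
  cubes.\<close>

lemma has_derivative_max0_power:
  assumes "n \<ge> 2"
  shows "((\<lambda>t::real. (max 0 t) ^ n) has_real_derivative real n * (max 0 t) ^ (n - 1)) (at t)"
proof -
  have n: "n \<noteq> 0" "(0::real) ^ (n - Suc 0) = 0" using assms by (auto simp: power_0_left)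
  consider "t < 0" | "t = 0" | "t > 0" by linarith
  then show ?thesis
  proof cases
    case 1
    have "((\<lambda>t::real. 0) has_real_derivative 0) (at t)" by simp
    then have "((\<lambda>t::real. (max 0 t) ^ n) has_real_derivative 0) (at t)"
      by (rule has_field_derivative_transform_within_open[where S="{..<0}"]) (use 1 assms in \<open>auto simp: max_def\<close>)
    moreover have "real n * (max 0 t) ^ (n - 1) = 0" using 1 n by simp
    ultimately show ?thesis by metis
  next
    case 3
    have "((\<lambda>t::real. t ^ n) has_real_derivative real n * t ^ (n - 1)) (at t)"
      using DERIV_pow by simp
    then have "((\<lambda>t::real. (max 0 t) ^ n) has_real_derivative real n * t ^ (n - 1)) (at t)"
      by (rule has_field_derivative_transform_within_open[where S="{0<..}"]) (use 3 in \<open>auto simp: max_def\<close>)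
    then show ?thesis using 3 by (simp add: max_def)
  next
    case 2
    have "((\<lambda>h. (max 0 h) ^ n / h) \<longlongrightarrow> 0) (at (0::real))"
    proof (rule Lim_null_comparison)
      show "\<forall>\<^sub>F h in at (0::real). norm ((max 0 h) ^ n / h) \<le> (max 0 h) ^ (n - 1)"
      proof (rule always_eventually, rule)
        fix h :: real
        have "(max 0 h) ^ n = (max 0 h) * (max 0 h) ^ (n - 1)"
          using assms by (metis Suc_1 Suc_le_D diff_Suc_1 power_Suc)
        then show "norm ((max 0 h) ^ n / h) \<le> (max 0 h) ^ (n - 1)"
          using assms by (cases "h > 0") (auto simp: max_def)
      qed
      have "((\<lambda>h. (max 0 h) ^ (n - 1)) \<longlongrightarrow> (max 0 (0::real)) ^ (n - 1)) (at 0)"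
        by (intro tendsto_intros)
      then show "((\<lambda>h::real. (max 0 h) ^ (n - 1)) \<longlongrightarrow> 0) (at 0)" using n by (simp only: max.idem) simp
    qed
    moreover have "(0::real) ^ n = 0" using n by simp
    ultimately show ?thesis using 2 n(2) by (simp only: DERIV_def max.idem add_0 diff_zero mult_zero_right One_nat_def)
  qed
qed

lemma C1_on_max0_power:
  fixes g :: "'a::real_normed_vector \<Rightarrow> real"
  assumes "n \<ge> 2" "C1_on S g"
  shows "C1_on S (\<lambda>x. (max 0 (g x)) ^ n)"
  using assms(2)
  by (rule C1_on_real_compose[where F' = "\<lambda>t. real n * (max 0 t) ^ (n - 1)"])
    (intro has_derivative_max0_power assms continuous_intros)+

lemma C1_on_box_bump: "C1_on S (box_bump a b)"
  unfolding box_bump_def[abs_def]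
  by (intro C1_on_prod C1_on_mult C1_on_max0_power C1_on_diff C1_on_nth C1_on_const) auto

lemma box_bump_nonneg: "0 \<le> box_bump a b x"
  unfolding box_bump_def by (intro prod_nonneg) auto

lemma box_bump_eq_0_iff: "box_bump a b x = 0 \<longleftrightarrow> x \<notin> box a b"
proof -
  have m: "max 0 t = 0 \<longleftrightarrow> t \<le> 0" for t :: real by (simp add: max_def)
  show ?thesis by (auto simp: box_bump_def mem_box_cart m not_less)
qed

section \<open>The fundamental lemma of the calculus of variations\<close>

context bounded_open
begin

text \<open>No mollification is involved: test functions approximating the indicator of a box make
  the integrals of \<open>g\<close> over small boxes vanish, which determines \<open>g\<close> on
  each such box, and countably many of them cover \<open>V\<close>.\<close>

lemma fundamental_lemma:
  assumes g: "L2 V g" and 0: "\<And>\<phi>. test_fun V \<phi> \<Longrightarrow> set_lebesgue_integral lebesgue V (\<lambda>x. g x * \<phi> x) = 0"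
  shows "AE x in lebesgue. x \<in> V \<longrightarrow> g x = 0"
proof -
  have box0: "set_lebesgue_integral lebesgue (box a b) g = 0" if ab: "cbox a b \<subseteq> V" for a b
  proof -
    \<comment> \<open>These test functions increase to the indicator function of the open box.\<close>
    let ?\<phi> = "\<lambda>n x. complex_of_real (1 - exp (- real n * box_bump a b x))"
    have t: "test_fun V (?\<phi> n)" for n
    proof (rule test_funI[OF _ compact_cbox ab])
      have "C1_on V (\<lambda>x. 1 - exp (- real n * box_bump a b x))"
        by (rule C1_on_real_compose[OF C1_on_box_bump, where F' = "\<lambda>t. real n * exp (- real n * t)"])
          (auto intro!: derivative_eq_intros continuous_intros)
      then show "C1_on V (?\<phi> n)" by (rule C1_on_of_real)
      show "x \<in> cbox a b" if "?\<phi> n x \<noteq> 0" for x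
        using that box_bump_eq_0_iff[of a b x] box_subset_cbox[of a b] by auto
    qed
    have si: "set_integrable lebesgue V g" using set_integrable_L2[OF g] .
    have "(\<lambda>n. LINT x:V|lebesgue. g x * ?\<phi> n x) \<longlonglongrightarrow> (LINT x|lebesgue. indicator V x *\<^sub>R (g x * indicator (box a b) x))"
      unfolding set_lebesgue_integral_def
    proof (rule integral_dominated_convergence[where w = "\<lambda>x. norm (indicator V x *\<^sub>R g x)"])
      have "(\<lambda>x. (indicator V x *\<^sub>R g x) * indicator (box a b) x) \<in> borel_measurable lebesgue"
        using si unfolding set_integrable_def
        by (intro borel_measurable_times borel_measurable_integrable borel_measurable_indicator) auto
      then show "(\<lambda>x. indicator V x *\<^sub>R (g x * indicator (box a b) x)) \<in> borel_measurable lebesgue" by simp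
      show "(\<lambda>x. indicator V x *\<^sub>R (g x * ?\<phi> n x)) \<in> borel_measurable lebesgue" for n
        using set_integrable_test(1)[OF g t[of n]] unfolding set_integrable_def by auto
      show "integrable lebesgue (\<lambda>x. norm (indicator V x *\<^sub>R g x))"
        using si unfolding set_integrable_def by (rule integrable_norm)
      show "AE x in lebesgue. (\<lambda>n. indicator V x *\<^sub>R (g x * ?\<phi> n x)) \<longlonglongrightarrow> indicator V x *\<^sub>R (g x * indicator (box a b) x)"
      proof (rule AE_I2)
        fix x
        have "(\<lambda>n. 1 - exp (- real n * box_bump a b x)) \<longlonglongrightarrow> indicator (box a b) x"
        proof (cases "x \<in> box a b")
          case True
          then have p: "box_bump a b x > 0" using box_bump_eq_0_iff[of a b x] box_bump_nonneg[of a b x] by linarith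
          have "filterlim (\<lambda>n. - (real n * box_bump a b x)) at_bot sequentially"
            unfolding filterlim_uminus_at_bot
            using filterlim_tendsto_pos_mult_at_top[OF tendsto_const p filterlim_real_sequentially]
            by (simp add: mult.commute)
          then have "(\<lambda>n. exp (- (real n * box_bump a b x))) \<longlonglongrightarrow> 0"
            by (rule filterlim_compose[OF exp_at_bot])
          then have "(\<lambda>n. 1 - exp (- (real n * box_bump a b x))) \<longlonglongrightarrow> 1 - 0"
            by (intro tendsto_diff tendsto_const)
          then show ?thesis using True by simp
        next
          case False
          then show ?thesis using box_bump_eq_0_iff[of a b x] by simp
        qed
        then have "(\<lambda>n. ?\<phi> n x) \<longlonglongrightarrow> of_real (indicator (box a b) x)"
          by (rule tendsto_of_real)
        then show "(\<lambda>n. indicator V x *\<^sub>R (g x * ?\<phi> n x)) \<longlonglongrightarrow> indicator V x *\<^sub>R (g x * indicator (box a b) x)"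
          by (intro tendsto_intros) (cases "x \<in> box a b", simp_all)
      qed
      show "AE x in lebesgue. norm (indicator V x *\<^sub>R (g x * ?\<phi> n x)) \<le> norm (indicator V x *\<^sub>R g x)" for n
      proof (rule AE_I2)
        fix x
        have "exp (- real n * box_bump a b x) \<le> 1" using box_bump_nonneg[of a b x] by simp
        then have "norm (?\<phi> n x) \<le> 1" unfolding norm_of_real by (smt (verit) exp_ge_zero)
        then show "norm (indicator V x *\<^sub>R (g x * ?\<phi> n x)) \<le> norm (indicator V x *\<^sub>R g x)"
          unfolding norm_scaleR norm_mult by (intro mult_left_mono mult_left_le) auto
      qed
    qed
    then have "(LINT x|lebesgue. indicator V x *\<^sub>R (g x * indicator (box a b) x)) = 0"
      unfolding 0[OF t] using LIMSEQ_unique tendsto_const by blast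
    moreover have "indicator V x *\<^sub>R (g x * indicator (box a b) x) = indicator (box a b) x *\<^sub>R g x" for x
      using ab box_subset_cbox[of a b] by (auto simp: indicator_def)
    ultimately show ?thesis by (simp add: set_lebesgue_integral_def)
  qed
  \<comment> \<open>The criterion on box integrals concerns all boxes of the whole space. Cutting
    \<open>g\<close> off to a box whose closed box lies in \<open>V\<close> reduces every box to its
    intersection with that one, to which \<open>box0\<close> applies.\<close>
  have ae: "AE x in lebesgue. x \<in> box c d \<longrightarrow> g x = 0" if cd: "cbox c d \<subseteq> V" for c d
  proof -
    have sub: "box c d \<subseteq> V" using cd box_subset_cbox by blast
    have "AE x in lebesgue. indicator (box c d) x *\<^sub>R g x = 0"
    proof (rule AE_zero_if_box_integrals_zero)
      show "integrable lebesgue (\<lambda>x. indicator (box c d) x *\<^sub>R g x)"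
        using set_integrable_subset[OF set_integrable_L2[OF g] _ sub] unfolding set_integrable_def by auto
      fix a b :: pt
      obtain a' b' where i: "box a b \<inter> box c d = box a' b'" using box_Int_box by blast
      have "set_lebesgue_integral lebesgue (box a' b') g = 0"
      \<comment> \<open>For an empty open box \<open>cbox a' b'\<close> may still be a nonempty
        degenerate box; only in the nonempty case is it the closure of
        \<open>box a' b'\<close>.\<close>
      proof (cases "box a' b' = {}")
        case True then show ?thesis by (simp add: set_lebesgue_integral_def)
      next
        case False
        then have "cbox a' b' = closure (box a' b')" by (simp add: closure_box)
        also have "\<dots> \<subseteq> closure (box c d)" unfolding i[symmetric] by (intro closure_mono) auto
        also have "\<dots> \<subseteq> cbox c d" by (intro closure_minimal box_subset_cbox closed_cbox)
        finally show ?thesis using cd by (intro box0) auto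
      qed
      moreover have "indicator (box a b) x *\<^sub>R indicator (box c d) x *\<^sub>R g x = indicator (box a' b') x *\<^sub>R g x" for x
        unfolding i[symmetric] by (simp add: indicator_def)
      then have "(\<lambda>x. indicator (box a b) x *\<^sub>R indicator (box c d) x *\<^sub>R g x)
          = (\<lambda>x. indicator (box a' b') x *\<^sub>R g x)" by blast
      ultimately show "set_lebesgue_integral lebesgue (box a b) (\<lambda>x. indicator (box c d) x *\<^sub>R g x) = 0"
        unfolding set_lebesgue_integral_def by metis
    qed
    then show ?thesis by (auto simp: indicator_def elim!: eventually_mono)
  qed
  define F where "F = {box a b |a b. cbox a b \<subseteq> V}"
  \<comment> \<open>The exceptional null set depends on the box, so the cover has to be reduced to a
    countable one before the null sets are united.\<close>
  have "\<And>S. S \<in> F \<Longrightarrow> open S" by (auto simp: F_def)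
  then obtain F' where F': "F' \<subseteq> F" "countable F'" "\<Union>F' = \<Union>F" by (rule Lindelof)
  have "V \<subseteq> \<Union>F"
  proof
    fix x assume "x \<in> V"
    then obtain a b where "cbox a b \<subseteq> V" "x \<in> box a b"
      using opn open_contains_cbox by metis
    then show "x \<in> \<Union>F" unfolding F_def by blast
  qed
  moreover have "AE x in lebesgue. \<forall>S\<in>F'. x \<in> S \<longrightarrow> g x = 0"
    using F' ae by (intro AE_ball_countable[THEN iffD2]) (auto simp: F_def)
  ultimately show ?thesis using F'(3) by (auto elim!: eventually_mono)
qed

text \<open>The difference of the two derivatives integrates to zero against every test function.
  Allowing \<open>f\<close> and \<open>f'\<close> to differ on a null set makes \<open>wd\<close>
  well defined on classes.\<close>

lemma is_weak_deriv_unique: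
  assumes "is_weak_deriv V j f g" "is_weak_deriv V j f' g'"
    and eq: "AE x in lebesgue. x \<in> V \<longrightarrow> f x = f' x"
    and L: "L2 V f" "L2 V f'"
  shows "AE x in lebesgue. x \<in> V \<longrightarrow> g x = g' x"
proof -
  have g: "L2 V g" "L2 V g'" using assms by (auto simp: is_weak_deriv_def)
  then have g'': "L2 V (\<lambda>x. - 1 * g' x)" by (intro L2_mult(1)[where M=1]) auto
  have "AE x in lebesgue. x \<in> V \<longrightarrow> g x + - 1 * g' x = 0"
  proof (rule fundamental_lemma)
    show "L2 V (\<lambda>x. g x + - 1 * g' x)" using L2_add(1)[OF g(1) g''] .
    fix \<phi> assume \<phi>: "test_fun V \<phi>"
    have "(LINT x:V|lebesgue. f x * partial j \<phi> x) = (LINT x:V|lebesgue. f' x * partial j \<phi> x)"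
      unfolding set_lebesgue_integral_def
      by (intro integral_cong_AE)
       (use set_integrable_test(2)[OF L(1) \<phi>, of j] set_integrable_test(2)[OF L(2) \<phi>, of j] eq in
         \<open>auto simp: set_integrable_def indicator_def elim!: eventually_mono\<close>)
    then have "(LINT x:V|lebesgue. g x * \<phi> x) = (LINT x:V|lebesgue. g' x * \<phi> x)"
      using assms(1,2) \<phi> by (auto simp: is_weak_deriv_def)
    then show "(LINT x:V|lebesgue. (g x + - 1 * g' x) * \<phi> x) = 0"
      using set_integrable_test(1)[OF g(1) \<phi>] set_integrable_test(1)[OF g(2) \<phi>]
      by (simp add: left_diff_distrib set_integral_diff)
  qed
  then show ?thesis by (auto elim!: eventually_mono)
qed

end

section \<open>Weak derivatives of constants\<close>

text \<open>Translation invariance of Lebesgue measure takes the place of Fubini's theorem and the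
  fundamental theorem of calculus. \<open>D\<close> is assumed continuous on \<open>K\<close> only,
  which suits a derivative cut off to zero outside a support.\<close>

lemma integral_derivative_compact_support:
  fixes \<psi> :: "'a::euclidean_space \<Rightarrow> 'b::euclidean_space"
  assumes K: "compact K" and 0: "\<And>x. x \<notin> K \<Longrightarrow> \<psi> x = 0" "\<And>x. x \<notin> K \<Longrightarrow> D x = 0"
    and D: "\<And>x. (\<psi> has_derivative blinfun_apply (D x)) (at x)" and cD: "continuous_on K D"
  shows "(\<lambda>x. blinfun_apply (D x) v) \<in> borel_measurable borel" "(\<integral>x. blinfun_apply (D x) v \<partial>lborel) = 0"
proof -
  obtain B where B: "\<And>x. norm (D x) \<le> B"
  proof -
    obtain B where "\<And>x. x \<in> K \<Longrightarrow> norm (D x) \<le> B"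
      using compact_imp_bounded[OF compact_continuous_image[OF cD K]] unfolding bounded_iff by auto
    then have "norm (D x) \<le> max 0 B" for x using 0(2)[of x] by (cases "x \<in> K") (auto simp: le_max_iff_disj)
    then show thesis by (rule that)
  qed
  have lip: "norm (\<psi> y - \<psi> x) \<le> B * norm (y - x)" for x y
    using differentiable_bound[OF convex_UNIV, of \<psi> "\<lambda>x. blinfun_apply (D x)" B y x] D B
    by (auto simp: norm_blinfun.rep_eq)
  have cont: "continuous_on S \<psi>" for S
    using D by (intro continuous_at_imp_continuous_on) (meson has_derivative_continuous)
  have mpsi [measurable]: "\<psi> \<in> borel_measurable borel"
    using cont by (rule borel_measurable_continuous_onI)
  have ipsi: "integrable lborel \<psi>"
  proof -
    have "integrable lborel (\<lambda>x. indicator K x *\<^sub>R \<psi> x)" by (rule borel_integrable_compact[OF K cont])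
    also have "(\<lambda>x. indicator K x *\<^sub>R \<psi> x) = \<psi>" using 0(1) by (auto simp: indicator_def)
    finally show ?thesis .
  qed
  have shift: "integrable lborel (\<lambda>x. \<psi> (a + x))" "(\<integral>x. \<psi> (a + x) \<partial>lborel) = (\<integral>x. \<psi> x \<partial>lborel)" for a
  proof -
    have d: "distr lborel borel ((+) a) = lborel" by (rule lborel_distr_plus)
    have "integrable (distr lborel borel ((+) a)) \<psi>" using ipsi unfolding d .
    then show "integrable lborel (\<lambda>x. \<psi> (a + x))" by (subst (asm) integrable_distr_eq) auto
    have "(\<integral>x. \<psi> x \<partial>distr lborel borel ((+) a)) = (\<integral>x. \<psi> (a + x) \<partial>lborel)"
      by (intro integral_distr) auto
    then show "(\<integral>x. \<psi> (a + x) \<partial>lborel) = (\<integral>x. \<psi> x \<partial>lborel)" unfolding d by simp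
  qed
  define h where "h n = 1 / real (Suc n)" for n
  have h: "0 < h n" "h n \<le> 1" for n by (auto simp: h_def)
  have h0: "h \<longlonglongrightarrow> 0" unfolding h_def by (rule LIMSEQ_Suc[OF lim_1_over_n])
  define q where "q n x = (\<psi> (h n *\<^sub>R v + x) - \<psi> x) /\<^sub>R h n" for n x
  \<comment> \<open>The difference quotients have integral \<open>0\<close> by translation invariance and converge dominatedly.\<close>
  have q0: "(\<integral>x. q n x \<partial>lborel) = 0" for n
    unfolding q_def using shift[of "h n *\<^sub>R v"] ipsi by simp
  have qlim: "(\<lambda>n. q n x) \<longlonglongrightarrow> blinfun_apply (D x) v" for x
  \<comment> \<open>The limit along \<open>at 0\<close> requires increments
    \<open>h n *\<^sub>R v\<close> that are never zero, which fails for v = 0.\<close>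
  proof (cases "v = 0")
    case True
    then show ?thesis by (simp add: q_def)
  next
    case False
    have "(\<lambda>k. norm (\<psi> (x + k) - \<psi> x - blinfun_apply (D x) k) / norm k) \<midarrow>0\<rightarrow> 0"
      using D[of x] unfolding has_derivative_at by blast
    moreover have "filterlim (\<lambda>n. h n *\<^sub>R v) (at 0) sequentially"
      unfolding filterlim_at using False h h0 tendsto_scaleR[OF h0 tendsto_const[of v]]
      by (auto intro!: always_eventually simp: less_imp_neq[symmetric])
    ultimately have "(\<lambda>n. norm (\<psi> (x + h n *\<^sub>R v) - \<psi> x - blinfun_apply (D x) (h n *\<^sub>R v)) / norm (h n *\<^sub>R v)) \<longlonglongrightarrow> 0"
      by (rule filterlim_compose)
    then have "(\<lambda>n. norm v * (norm (\<psi> (x + h n *\<^sub>R v) - \<psi> x - blinfun_apply (D x) (h n *\<^sub>R v)) / norm (h n *\<^sub>R v))) \<longlonglongrightarrow> 0"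
      by (rule tendsto_mult_right_zero)
    moreover have "norm v * (norm (\<psi> (x + h n *\<^sub>R v) - \<psi> x - blinfun_apply (D x) (h n *\<^sub>R v)) / norm (h n *\<^sub>R v))
       = norm (q n x - blinfun_apply (D x) v)" for n
    proof -
      have "q n x - blinfun_apply (D x) v = (\<psi> (x + h n *\<^sub>R v) - \<psi> x - blinfun_apply (D x) (h n *\<^sub>R v)) /\<^sub>R h n"
        using h(1)[of n] by (simp add: q_def blinfun.scaleR_right scaleR_diff_right add.commute)
      then show ?thesis using h(1)[of n] False by (simp add: divide_inverse mult.commute)
    qed
    ultimately have "(\<lambda>n. norm (q n x - blinfun_apply (D x) v)) \<longlonglongrightarrow> 0" by simp
    then show ?thesis by (simp add: LIM_zero_cancel tendsto_norm_zero_iff)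
  qed
  have mq [measurable]: "q n \<in> borel_measurable borel" for n
    unfolding q_def by measurable
  \<comment> \<open>Measurability comes from the pointwise limit of the difference quotients, since
    \<open>D\<close> is not known to be continuous across the boundary of \<open>K\<close>.\<close>
  show mD: "(\<lambda>x. blinfun_apply (D x) v) \<in> borel_measurable borel"
    by (rule borel_measurable_LIMSEQ_metric[OF mq qlim])
  obtain R where R: "\<And>x. x \<in> K \<Longrightarrow> norm x \<le> R" using compact_imp_bounded[OF K] unfolding bounded_iff by auto
  \<comment> \<open>The majorant is the Lipschitz bound on a ball: \<open>h n \<le> 1\<close> moves
    points by at most \<open>norm v\<close>, so outside radius \<open>R + norm v\<close> both values
    of \<psi> in the quotient are zero.\<close>
  have "(\<lambda>n. \<integral>x. q n x \<partial>lborel) \<longlonglongrightarrow> (\<integral>x. blinfun_apply (D x) v \<partial>lborel)"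
  proof (rule integral_dominated_convergence[where w = "\<lambda>x. indicator (cball 0 (R + norm v)) x *\<^sub>R (B * norm v)"])
    show "integrable lborel (\<lambda>x. indicator (cball (0::'a) (R + norm v)) x *\<^sub>R (B * norm v))"
      by (rule borel_integrable_compact) auto
    show "AE x in lborel. norm (q n x) \<le> indicator (cball 0 (R + norm v)) x *\<^sub>R (B * norm v)" for n
    proof (rule AE_I2)
      fix x
      show "norm (q n x) \<le> indicator (cball 0 (R + norm v)) x *\<^sub>R (B * norm v)"
      proof (cases "norm x \<le> R + norm v")
        case True
        have "norm (\<psi> (h n *\<^sub>R v + x) - \<psi> x) \<le> B * (h n * norm v)"
          using lip[of "h n *\<^sub>R v + x" x] h(1)[of n] by simp
        then have "norm (\<psi> (h n *\<^sub>R v + x) - \<psi> x) / h n \<le> B * norm v"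
          using h(1)[of n] by (simp add: pos_divide_le_eq mult_ac)
        then have "norm (q n x) \<le> B * norm v" using h(1)[of n] by (simp add: q_def divide_inverse mult.commute)
        then show ?thesis using True by simp
      next
        case False
        have "norm (h n *\<^sub>R v) \<le> norm v" using h[of n] by (simp add: mult_left_le_one_le)
        then have "norm (h n *\<^sub>R v + x) > R" using False norm_triangle_ineq[of "h n *\<^sub>R v + x" "- (h n *\<^sub>R v)"] by simp
        moreover have "norm x > R" using False norm_ge_zero[of v] by linarith
        ultimately have "x \<notin> K" "h n *\<^sub>R v + x \<notin> K" using R by (auto simp: not_le[symmetric])
        then show ?thesis using False by (simp add: q_def 0)
      qed
    qed
  qed (use mD qlim in auto)
  then show "(\<integral>x. blinfun_apply (D x) v \<partial>lborel) = 0"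
    unfolding q0 using LIMSEQ_unique tendsto_const by blast
qed

context bounded_open
begin

text \<open>Extension by zero turns the test function into a differentiable function on the whole
  space: near \<open>V\<close> nothing changes, and off the compact set \<open>K\<close> the
  extension vanishes on an open set.\<close>

lemma integral_partial_test_fun:
  assumes "test_fun V \<phi>"
  shows "set_lebesgue_integral lebesgue V (partial j \<phi>) = 0"
proof -
  obtain K where K: "compact K" "K \<subseteq> V" "\<And>x. x \<in> V - K \<Longrightarrow> \<phi> x = 0" "\<And>x j. x \<in> V - K \<Longrightarrow> partial j \<phi> x = 0"
    using test_fun_supportE[OF assms opn] by blast
  have "C1_on V \<phi>" using assms by (simp add: test_fun_iff)
  then obtain D where D: "\<forall>x\<in>V. (\<phi> has_derivative blinfun_apply (D x)) (at x)" "continuous_on V D"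
    unfolding C1_on_def by blast
  define E where "E x = (if x \<in> K then D x else 0)" for x
  define \<psi> where "\<psi> x = (if x \<in> V then \<phi> x else 0)" for x
  have E: "(\<psi> has_derivative blinfun_apply (E x)) (at x)" for x
  proof (cases "x \<in> K")
    case True
    then have "x \<in> V" using K(2) by auto
    have "(\<psi> has_derivative blinfun_apply (D x)) (at x)"
      by (rule has_derivative_transform_within_open[OF bspec[OF D(1) \<open>x \<in> V\<close>] opn \<open>x \<in> V\<close>]) (simp add: \<psi>_def)
    then show ?thesis using True by (simp add: E_def)
  next
    case False
    have "(\<psi> has_derivative (\<lambda>_. 0)) (at x)"
    proof (rule has_derivative_transform_within_open[OF has_derivative_const[where c=0]])
      show "open (- K)" using K(1) by (simp add: compact_imp_closed open_Compl)
      show "x \<in> - K" using False by simp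
      show "0 = \<psi> y" if "y \<in> - K" for y using that K(3)[of y] by (auto simp: \<psi>_def)
    qed
    then show ?thesis using False by (simp add: E_def zero_blinfun.rep_eq)
  qed
  have cE: "continuous_on K E"
    using continuous_on_subset[OF D(2) K(2)] by (rule continuous_on_eq) (simp add: E_def)
  have z: "\<psi> x = 0" "E x = 0" if "x \<notin> K" for x
    using that K(3)[of x] by (auto simp: \<psi>_def E_def)
  note I = integral_derivative_compact_support[OF K(1) z E cE, of "axis j 1"]
  have "indicator V x *\<^sub>R partial j \<phi> x = blinfun_apply (E x) (axis j 1)" for x
  proof (cases "x \<in> K")
    case True
    then have "x \<in> V" using K(2) by auto
    then show ?thesis using True partial_eq[OF bspec[OF D(1) \<open>x \<in> V\<close>], of j] by (simp add: E_def)
  next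
    case False
    then show ?thesis using K(4)[of x j] by (simp add: E_def indicator_def zero_blinfun.rep_eq)
  qed
  then have "set_lebesgue_integral lebesgue V (partial j \<phi>) = (\<integral>x. blinfun_apply (E x) (axis j 1) \<partial>lebesgue)"
    unfolding set_lebesgue_integral_def by metis
  also have "\<dots> = (\<integral>x. blinfun_apply (E x) (axis j 1) \<partial>lborel)"
    using I(1) by (intro integral_completion) simp
  finally show ?thesis using I(2) by simp
qed

text \<open>Constants matter twice: 0 is the first component of every value of A_3 and A_4, and 1
  yields the element of the kernel that witnesses the failure of exactness.\<close>

lemma is_weak_deriv_const: "is_weak_deriv V j (\<lambda>_. c) (\<lambda>_. 0)"
  using L2_cont[of "\<lambda>_. 0" 0] integral_partial_test_fun
  unfolding is_weak_deriv_def by simp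

end

section \<open>Koszul complexes modulo null elements\<close>

text \<open>An abstract commuting tuple on a quotient that is never formed: \<open>Z\<close> marks
  the representatives of zero and all laws hold modulo \<open>Z\<close>. Additivity suffices in
  place of linearity, because the spectral parameter is already absorbed in the operators
  \<open>S i\<close>.\<close>

locale koszul_tuple =
  fixes Z :: "'v::ab_group_add \<Rightarrow> bool" and C :: "'v set" and S :: "nat \<Rightarrow> 'v \<Rightarrow> 'v"
  assumes Z_0: "Z 0" and Z_add: "Z x \<Longrightarrow> Z y \<Longrightarrow> Z (x + y)" and Z_minus: "Z x \<Longrightarrow> Z (- x)"
    and C_0: "0 \<in> C" and C_add: "x \<in> C \<Longrightarrow> y \<in> C \<Longrightarrow> x + y \<in> C" and C_minus: "x \<in> C \<Longrightarrow> - x \<in> C"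
    and S_C: "x \<in> C \<Longrightarrow> S i x \<in> C"
    and S_cong: "x \<in> C \<Longrightarrow> y \<in> C \<Longrightarrow> Z (x - y) \<Longrightarrow> Z (S i x - S i y)"
    and S_add: "x \<in> C \<Longrightarrow> y \<in> C \<Longrightarrow> Z (S i (x + y) - (S i x + S i y))"
    and S_comm: "x \<in> C \<Longrightarrow> Z (S i (S j x) - S j (S i x))"
begin

definition eqv :: "'v \<Rightarrow> 'v \<Rightarrow> bool" (infix "\<simeq>" 50) where "x \<simeq> y \<longleftrightarrow> Z (x - y)"

lemma eqv_refl [simp]: "x \<simeq> x" by (simp add: eqv_def Z_0)
lemma eqv_sym: "x \<simeq> y \<Longrightarrow> y \<simeq> x" using Z_minus[of "x - y"] by (simp add: eqv_def)
lemma eqv_trans [trans]: "x \<simeq> y \<Longrightarrow> y \<simeq> z \<Longrightarrow> x \<simeq> z"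
  using Z_add[of "x - y" "y - z"] by (simp add: eqv_def)
lemma eqv_add: "x \<simeq> y \<Longrightarrow> x' \<simeq> y' \<Longrightarrow> x + x' \<simeq> y + y'"
  using Z_add[of "x - y" "x' - y'"] by (simp add: eqv_def algebra_simps)
lemma eqv_minus: "x \<simeq> y \<Longrightarrow> - x \<simeq> - y"
  using Z_minus[of "x - y"] by (simp add: eqv_def)
lemma eqv_sum: "(\<And>i. i \<in> A \<Longrightarrow> x i \<simeq> y i) \<Longrightarrow> sum x A \<simeq> sum y A"
  by (induction A rule: infinite_finite_induct) (auto intro: eqv_add)
lemma C_sum: "(\<And>i. i \<in> A \<Longrightarrow> x i \<in> C) \<Longrightarrow> sum x A \<in> C"
  by (induction A rule: infinite_finite_induct) (auto intro: C_add C_0)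
lemma C_diff: "x \<in> C \<Longrightarrow> y \<in> C \<Longrightarrow> x - y \<in> C"
  using C_add[of x "- y"] C_minus by simp
lemma S_eqv: "x \<in> C \<Longrightarrow> y \<in> C \<Longrightarrow> x \<simeq> y \<Longrightarrow> S i x \<simeq> S i y"
  using S_cong by (simp add: eqv_def)

lemma S_0: "S i 0 \<simeq> 0"
proof -
  have "0 - S i 0 \<simeq> 0" using S_add[OF C_0 C_0, of i] by (simp add: eqv_def)
  from eqv_minus[OF this] show ?thesis by simp
qed

lemma S_minus: assumes "x \<in> C" shows "S i (- x) \<simeq> - S i x"
proof -
  have "S i x + S i (- x) \<simeq> S i (x + - x)"
    using eqv_sym[unfolded eqv_def, OF S_add[OF assms C_minus[OF assms], of i]] by (simp add: eqv_def)
  also have "\<dots> \<simeq> 0" using S_0 by simp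
  finally have "- S i x + (S i x + S i (- x)) \<simeq> - S i x + 0" by (intro eqv_add) auto
  then show ?thesis by simp
qed

lemma S_sum: "(\<And>k. k \<in> A \<Longrightarrow> x k \<in> C) \<Longrightarrow> S i (sum x A) \<simeq> (\<Sum>k\<in>A. S i (x k))"
proof (induction A rule: infinite_finite_induct)
  case (insert a A)
  then have "S i (x a + sum x A) \<simeq> S i (x a) + S i (sum x A)"
    using S_add[of "x a" "sum x A" i] C_sum[of A x] by (simp add: eqv_def)
  also have "\<dots> \<simeq> S i (x a) + (\<Sum>k\<in>A. S i (x k))" using insert by (intro eqv_add) auto
  finally show ?case using insert by simp
qed (use S_0 in auto)

section \<open>The Koszul differential, its exactness, and adjunction of one operator\<close>

definition sgn_op :: "nat \<Rightarrow> 'v \<Rightarrow> 'v" where "sgn_op k = (if even k then (\<lambda>v. v) else uminus)"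

lemma sgn_op_eqv: "x \<simeq> y \<Longrightarrow> sgn_op k x \<simeq> sgn_op k y"
  by (simp add: sgn_op_def eqv_minus)
lemma sgn_op_C: "x \<in> C \<Longrightarrow> sgn_op k x \<in> C" by (simp add: sgn_op_def C_minus)
lemma sgn_op_S: "x \<in> C \<Longrightarrow> S i (sgn_op k x) \<simeq> sgn_op k (S i x)"
  by (simp add: sgn_op_def S_minus)
lemma sgn_op_diff: "sgn_op k (x - y) = sgn_op k x - sgn_op k y" by (simp add: sgn_op_def)
lemma sgn_op_sgn_op: "sgn_op k (sgn_op l x) = sgn_op l (sgn_op k x)" by (simp add: sgn_op_def)
lemma sgn_op_Suc: "sgn_op (Suc k) x = - sgn_op k x" by (simp add: sgn_op_def)

definition kd :: "nat \<Rightarrow> (nat set \<Rightarrow> 'v) \<Rightarrow> nat set \<Rightarrow> 'v" where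
  "kd n \<omega> J = (\<Sum>i\<in>{i. i < n \<and> i \<notin> J}. sgn_op (card {j\<in>J. j < i}) (S i (\<omega> (insert i J))))"

definition forms :: "nat \<Rightarrow> nat \<Rightarrow> (nat set \<Rightarrow> 'v) set" where
  "forms n k = {\<omega>. \<forall>K. K \<subseteq> {..<n} \<and> card K = k \<longrightarrow> \<omega> K \<in> C}"

text \<open>At \<open>k = 0\<close> this says that the ranges of the \<open>S i\<close> span the
  space; at \<open>k = n\<close> it says that their joint kernel is trivial, since
  \<open>kd n \<eta> {..<n}\<close> is an empty sum.\<close>

definition exact_at :: "nat \<Rightarrow> nat \<Rightarrow> bool" where
  "exact_at n k \<longleftrightarrow> (\<forall>\<omega>\<in>forms n k.
     (k = 0 \<or> (\<forall>J. J \<subseteq> {..<n} \<and> card J = k - 1 \<longrightarrow> kd n \<omega> J \<simeq> 0)) \<longrightarrow>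
     (\<exists>\<eta>\<in>forms n (Suc k). \<forall>J. J \<subseteq> {..<n} \<and> card J = k \<longrightarrow> kd n \<eta> J \<simeq> \<omega> J))"

lemma formsD: "\<omega> \<in> forms n k \<Longrightarrow> K \<subseteq> {..<n} \<Longrightarrow> card K = k \<Longrightarrow> \<omega> K \<in> C"
  by (auto simp: forms_def)

lemma forms_insert:
  assumes "\<omega> \<in> forms n (Suc k)" "J \<subseteq> {..<n}" "card J = k" "i < n" "i \<notin> J"
  shows "\<omega> (insert i J) \<in> C"
  using assms finite_subset[OF assms(2)] by (intro formsD[OF assms(1)]) auto

lemma kd_cong:
  assumes "\<And>i. i < n \<Longrightarrow> i \<notin> J \<Longrightarrow> \<omega> (insert i J) = \<omega>' (insert i J)"
  shows "kd n \<omega> J = kd n \<omega>' J"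
  unfolding kd_def by (intro sum.cong) (auto simp: assms)

text \<open>The new index \<open>n\<close> lies above all elements of \<open>J\<close>, so its sign
  counts the whole of \<open>J\<close> while the old signs stay as they were. Together with
  \<open>kd_Suc_insert\<close> this is the block form of a mapping cone differential.\<close>

lemma kd_Suc_notin:
  assumes "n \<notin> J" "J \<subseteq> {..<n}"
  shows "kd (Suc n) \<omega> J = kd n \<omega> J + sgn_op (card J) (S n (\<omega> (insert n J)))"
proof -
  have "{i. i < Suc n \<and> i \<notin> J} = insert n {i. i < n \<and> i \<notin> J}" using assms by auto
  moreover have "{j\<in>J. j < n} = J" using assms by auto
  ultimately show ?thesis by (simp add: kd_def add.commute)
qed

lemma kd_Suc_insert:
  assumes "J \<subseteq> {..<n}"
  shows "kd (Suc n) \<omega> (insert n J) = kd n (\<lambda>K. \<omega> (insert n K)) J"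
proof -
  have "{i. i < Suc n \<and> i \<notin> insert n J} = {i. i < n \<and> i \<notin> J}" by auto
  moreover have "{j \<in> insert n J. j < i} = {j\<in>J. j < i}" if "i < n" for i using that by auto
  ultimately show ?thesis unfolding kd_def by (intro sum.cong) (auto simp: insert_commute)
qed

lemma kd_diff:
  assumes "\<omega> \<in> forms n (Suc k)" "\<omega>' \<in> forms n (Suc k)" "J \<subseteq> {..<n}" "card J = k"
  shows "kd n (\<lambda>K. \<omega> K - \<omega>' K) J \<simeq> kd n \<omega> J - kd n \<omega>' J"
proof -
  have "kd n (\<lambda>K. \<omega> K - \<omega>' K) J \<simeq>
     (\<Sum>i\<in>{i. i < n \<and> i \<notin> J}. sgn_op (card {j\<in>J. j < i}) (S i (\<omega> (insert i J)) - S i (\<omega>' (insert i J))))"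
    unfolding kd_def
  proof (intro eqv_sum sgn_op_eqv)
    fix i assume i: "i \<in> {i. i < n \<and> i \<notin> J}"
    let ?a = "\<omega> (insert i J)" and ?b = "\<omega>' (insert i J)"
    have C: "?a \<in> C" "?b \<in> C" using i assms by (auto intro!: forms_insert)
    have "S i (?a + - ?b) \<simeq> S i ?a + S i (- ?b)" 
      unfolding eqv_def by (rule S_add[OF C(1) C_minus[OF C(2)]])
    also have "\<dots> \<simeq> S i ?a + - S i ?b" using C by (intro eqv_add S_minus) auto
    finally show "S i (?a - ?b) \<simeq> S i ?a - S i ?b" by simp
  qed
  also have "\<dots> = kd n \<omega> J - kd n \<omega>' J"
    by (simp add: kd_def sgn_op_diff sum_subtractf)
  finally show ?thesis .
qed

text \<open>By commutativity each \<open>S m\<close> is a chain map. The sign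
  \<open>sgn_op l\<close> is carried along because the correction term in the cone argument contains
  it.\<close>

lemma S_kd:
  assumes "\<omega> \<in> forms n (Suc k)" "J \<subseteq> {..<n}" "card J = k"
  shows "kd n (\<lambda>K. sgn_op l (S m (\<omega> K))) J \<simeq> sgn_op l (S m (kd n \<omega> J))"
proof -
  have C: "\<omega> (insert i J) \<in> C" if "i \<in> {i. i < n \<and> i \<notin> J}" for i
    using that assms by (auto intro!: forms_insert)
  have "sgn_op l (S m (kd n \<omega> J)) \<simeq> sgn_op l (\<Sum>i\<in>{i. i < n \<and> i \<notin> J}. S m (sgn_op (card {j\<in>J. j < i}) (S i (\<omega> (insert i J)))))"
    unfolding kd_def using C by (intro sgn_op_eqv S_sum sgn_op_C S_C) auto
  also have "\<dots> = (\<Sum>i\<in>{i. i < n \<and> i \<notin> J}. sgn_op l (S m (sgn_op (card {j\<in>J. j < i}) (S i (\<omega> (insert i J))))))"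
    by (simp add: sgn_op_def sum_negf)
  also have "\<dots> \<simeq> kd n (\<lambda>K. sgn_op l (S m (\<omega> K))) J"
    unfolding kd_def
  proof (intro eqv_sum)
    fix i assume i: "i \<in> {i. i < n \<and> i \<notin> J}"
    let ?k = "card {j\<in>J. j < i}" and ?a = "\<omega> (insert i J)"
    have "sgn_op l (S m (sgn_op ?k (S i ?a))) \<simeq> sgn_op l (sgn_op ?k (S m (S i ?a)))"
      using C[OF i] by (intro sgn_op_eqv sgn_op_S S_C)
    also have "\<dots> \<simeq> sgn_op l (sgn_op ?k (S i (S m ?a)))"
      using C[OF i] S_comm by (intro sgn_op_eqv) (simp add: eqv_def)
    also have "\<dots> = sgn_op ?k (sgn_op l (S i (S m ?a)))" by (rule sgn_op_sgn_op)
    also have "\<dots> \<simeq> sgn_op ?k (S i (sgn_op l (S m ?a)))"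
      using C[OF i] by (intro sgn_op_eqv eqv_sym[OF sgn_op_S] S_C)
    finally show "sgn_op l (S m (sgn_op ?k (S i ?a))) \<simeq> sgn_op ?k (S i (sgn_op l (S m ?a)))" .
  qed
  finally show ?thesis by (rule eqv_sym)
qed

text \<open>A mapping cone of an exact complex is exact, whichever chain map is used. Degree
  \<open>k\<close> of the cone involves degrees \<open>k - 1\<close> and \<open>k\<close> of the
  smaller complex, so exactness is assumed in all degrees at once.\<close>

lemma exact_at_Suc:
  assumes ex: "\<And>k. k \<le> n \<Longrightarrow> exact_at n k" and k: "k \<le> Suc n"
  shows "exact_at (Suc n) k"
  unfolding exact_at_def
proof (intro ballI impI)
  fix \<omega> assume w: "\<omega> \<in> forms (Suc n) k"
    and cl: "k = 0 \<or> (\<forall>J. J \<subseteq> {..<Suc n} \<and> card J = k - 1 \<longrightarrow> kd (Suc n) \<omega> J \<simeq> 0)"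
  have sub: "J \<subseteq> {..<Suc n}" if "J \<subseteq> {..<n}" for J using that by auto
  have ins: "insert n J \<subseteq> {..<Suc n}" "card (insert n J) = Suc (card J)" if "J \<subseteq> {..<n}" for J
    using that finite_subset[OF that] by (auto intro!: card_insert_disjoint)
  \<comment> \<open>Splitting a form by whether its index set contains \<open>n\<close> makes the complex of \<open>Suc n\<close> operators the
    mapping cone of \<open>S n\<close> on the complex of \<open>n\<close> operators. \<open>\<eta>1\<close> solves for the part containing \<open>n\<close>, and
    \<open>\<omega>'\<close> is what remains of the other part.\<close>
  obtain \<eta>1 where h1: "\<eta>1 \<in> forms n k"
    "\<And>J. k \<noteq> 0 \<Longrightarrow> J \<subseteq> {..<n} \<Longrightarrow> card J = k - 1 \<Longrightarrow> kd n \<eta>1 J \<simeq> \<omega> (insert n J)"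
  proof (cases k)
    case 0
    then show thesis by (intro that[of "\<lambda>_. 0"]) (auto simp: forms_def C_0)
  next
    case (Suc k')
    have "(\<lambda>K. \<omega> (insert n K)) \<in> forms n k'"
      using w ins Suc unfolding forms_def by auto
    moreover have "kd n (\<lambda>K. \<omega> (insert n K)) J \<simeq> 0" if "k' \<noteq> 0" "J \<subseteq> {..<n}" "card J = k' - 1" for J
    proof -
      have "card (insert n J) = k - 1" using ins(2)[OF that(2)] that Suc by simp
      then have "kd (Suc n) \<omega> (insert n J) \<simeq> 0" using cl ins(1)[OF that(2)] Suc by blast
      then show ?thesis using kd_Suc_insert[OF that(2), of \<omega>] by simp
    qed
    ultimately obtain \<eta> where "\<eta> \<in> forms n (Suc k')"
      "\<forall>J. J \<subseteq> {..<n} \<and> card J = k' \<longrightarrow> kd n \<eta> J \<simeq> \<omega> (insert n J)"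
      using ex[of k'] k Suc unfolding exact_at_def by (metis Suc_le_mono)
    then show thesis using Suc by (intro that[of \<eta>]) auto
  qed
  define \<omega>' where "\<omega>' K = \<omega> K - sgn_op k (S n (\<eta>1 K))" for K
  have w0: "\<omega> \<in> forms n k" using w sub unfolding forms_def by auto
  have s1: "(\<lambda>K. sgn_op k (S n (\<eta>1 K))) \<in> forms n k"
    using h1(1) unfolding forms_def by (auto intro!: sgn_op_C S_C)
  have "\<omega>' K \<in> C" if K: "K \<subseteq> {..<n}" "card K = k" for K
    unfolding \<omega>'_def using formsD[OF w0 K] formsD[OF s1 K] by (rule C_diff)
  then have w': "\<omega>' \<in> forms n k" unfolding forms_def by blast
  have cl': "kd n \<omega>' J \<simeq> 0" if k0: "k \<noteq> 0" and J: "J \<subseteq> {..<n}" "card J = k - 1" for J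
  proof -
    obtain k' where k': "k = Suc k'" using k0 by (cases k) auto
    have J': "card J = k'" "n \<notin> J" using J k' by auto
    note w0 = w0[unfolded k'] and s1 = s1[unfolded k'] and h = h1(1)[unfolded k']
    have C1: "kd n \<eta>1 J \<in> C" unfolding kd_def
      using h J J' by (intro C_sum sgn_op_C S_C) (auto intro: forms_insert)
    have C2: "\<omega> (insert n J) \<in> C" using w ins[OF J(1)] J'(1) k' by (auto intro: formsD)
    have "kd n \<omega>' J \<simeq> kd n \<omega> J - kd n (\<lambda>K. sgn_op (Suc k') (S n (\<eta>1 K))) J"
      unfolding \<omega>'_def k' by (rule kd_diff[OF w0 s1 J(1) J'(1)])
    also have "\<dots> = kd n \<omega> J + - kd n (\<lambda>K. sgn_op (Suc k') (S n (\<eta>1 K))) J" by simp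
    also have "\<dots> \<simeq> kd n \<omega> J + - sgn_op (Suc k') (S n (kd n \<eta>1 J))"
      by (intro eqv_add eqv_minus S_kd[OF h J(1) J'(1)] eqv_refl)
    also have "\<dots> \<simeq> kd n \<omega> J + - sgn_op (Suc k') (S n (\<omega> (insert n J)))"
      by (intro eqv_add eqv_minus sgn_op_eqv S_eqv C1 C2 h1(2)[OF k0 J] eqv_refl)
    \<comment> \<open>The minus sign turns \<open>sgn_op (Suc k')\<close> into
      \<open>sgn_op k'\<close> with \<open>k' = card J\<close>, which is the sign of the term with
      index \<open>n\<close> in the larger differential.\<close>
    also have "\<dots> = kd (Suc n) \<omega> J"
      using kd_Suc_notin[OF J'(2) J(1), of \<omega>] J'(1) by (simp add: sgn_op_Suc)
    also have "\<dots> \<simeq> 0" using cl k0 sub[OF J(1)] J(2) by auto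
    finally show ?thesis .
  qed
  obtain \<eta>0 where h0: "\<eta>0 \<in> forms n (Suc k)"
    "\<And>J. J \<subseteq> {..<n} \<Longrightarrow> card J = k \<Longrightarrow> kd n \<eta>0 J \<simeq> \<omega>' J"
  proof (cases "k \<le> n")
    case True
    then show thesis using ex[OF True] w' cl' that unfolding exact_at_def by metis
  next
    case False
    \<comment> \<open>In the top degree \<open>k = Suc n\<close> no subset of \<open>{..<n}\<close>
      has \<open>k\<close> elements, so the condition is void and the zero form serves.\<close>
    have "card J \<noteq> k" if "J \<subseteq> {..<n}" for J using card_mono[OF _ that] False by auto
    then show thesis by (intro that[of "\<lambda>_. 0"]) (auto simp: forms_def C_0)
  qed
  define \<eta> where "\<eta> K = (if n \<in> K then \<eta>1 (K - {n}) else \<eta>0 K)" for K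
  have split: "K \<subseteq> {..<n} \<or> (\<exists>L. K = insert n L \<and> L \<subseteq> {..<n})" if "K \<subseteq> {..<Suc n}" for K
  proof (cases "n \<in> K")
    case True
    then show ?thesis using that by (intro disjI2 exI[of _ "K - {n}"]) auto
  next
    case False
    then show ?thesis using that by (auto simp: less_Suc_eq)
  qed
  have \<eta>_in: "\<eta> (insert n L) = \<eta>1 L" if "L \<subseteq> {..<n}" for L
  proof -
    have "insert n L - {n} = L" using that by auto
    then show ?thesis by (simp add: \<eta>_def)
  qed
  show "\<exists>\<eta>\<in>forms (Suc n) (Suc k). \<forall>J. J \<subseteq> {..<Suc n} \<and> card J = k \<longrightarrow> kd (Suc n) \<eta> J \<simeq> \<omega> J"
  proof (intro bexI[of _ \<eta>] allI impI)
    have "\<eta> K \<in> C" if K: "K \<subseteq> {..<Suc n}" "card K = Suc k" for K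
      using split[OF K(1)]
    proof (elim disjE exE conjE)
      assume "K \<subseteq> {..<n}"
      moreover from this have "n \<notin> K" by auto
      ultimately show ?thesis using formsD[OF h0(1)] K(2) by (simp add: \<eta>_def)
    next
      fix L assume L: "K = insert n L" "L \<subseteq> {..<n}"
      then show ?thesis using formsD[OF h1(1) L(2)] ins[OF L(2)] K(2) \<eta>_in[OF L(2)] by simp
    qed
    then show "\<eta> \<in> forms (Suc n) (Suc k)" unfolding forms_def by auto
  next
    fix J assume "J \<subseteq> {..<Suc n} \<and> card J = k"
    then have J: "J \<subseteq> {..<Suc n}" "card J = k" by auto
    from split[OF J(1)] show "kd (Suc n) \<eta> J \<simeq> \<omega> J"
    proof (elim disjE exE conjE)
      assume J': "J \<subseteq> {..<n}"
      then have nJ: "n \<notin> J" by auto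
      have "kd (Suc n) \<eta> J = kd n \<eta>0 J + sgn_op k (S n (\<eta>1 J))"
        using kd_Suc_notin[OF nJ J', of \<eta>] \<eta>_in[OF J'] J(2) nJ
        by (auto simp: \<eta>_def intro!: kd_cong)
      also have "\<dots> \<simeq> \<omega>' J + sgn_op k (S n (\<eta>1 J))"
        by (intro eqv_add h0(2)[OF J' J(2)] eqv_refl)
      also have "\<dots> = \<omega> J" by (simp add: \<omega>'_def)
      finally show ?thesis .
    next
      fix L assume L: "J = insert n L" "L \<subseteq> {..<n}"
      then have c: "k \<noteq> 0" "card L = k - 1" using ins[OF L(2)] J(2) by auto
      have "kd (Suc n) \<eta> J = kd n (\<lambda>K. \<eta> (insert n K)) L" unfolding L(1) by (rule kd_Suc_insert[OF L(2)])
      also have "\<dots> = kd n \<eta>1 L" using L(2) by (intro kd_cong \<eta>_in) auto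
      also have "\<dots> \<simeq> \<omega> J" unfolding L(1) by (rule h1(2)[OF c(1) L(2) c(2)])
      finally show ?thesis .
    qed
  qed
qed

lemma exact_at_mono:
  assumes "\<And>k. k \<le> m \<Longrightarrow> exact_at m k" "m \<le> n" "k \<le> n" shows "exact_at n k"
  using assms(2,3)
proof (induction n arbitrary: k rule: dec_induct)
  case (step n)
  then show ?case by (intro exact_at_Suc) auto
qed (rule assms(1))

end

lemma taylor_regular_iff_exact_at:
  assumes "koszul_tuple Z C (\<lambda>i v. T i v - sc (lam i) v)"
  shows "taylor_regular sc Z C T n lam \<longleftrightarrow>
    (\<forall>k\<le>n. koszul_tuple.exact_at Z C (\<lambda>i v. T i v - sc (lam i) v) n k)"
proof -
  interpret koszul_tuple Z C "\<lambda>i v. T i v - sc (lam i) v" by fact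
  have "koszul_d sc T n lam = kd n"
    by (intro ext) (simp add: koszul_d_def kd_def sgn_op_def)
  then show ?thesis unfolding taylor_regular_def exact_at_def forms_def eqv_def
    by (simp add: Ball_def Bex_def)
qed

section \<open>Multiplication operators and Cauchy--Riemann operators\<close>

definition M_op :: "fn \<Rightarrow> xel \<Rightarrow> xel" where
  "M_op h u = ((\<lambda>x. h x * fst u x), (\<lambda>x. h x * snd u x))"

definition D_op :: "pt set \<Rightarrow> nat \<Rightarrow> xel \<Rightarrow> xel" where
  "D_op V k u = ((\<lambda>x. 0), dzbar V k (fst u))"

text \<open>For \<open>k = 2\<close> the second index is \<open>of_nat 4 = (0 :: 4)\<close>, which is the same coordinate as \<open>4\<close>.\<close>

definition dbar :: "nat \<Rightarrow> fn \<Rightarrow> fn" where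
  "dbar k h x = (partial (of_nat (2*k - 1)) h x + \<i> * partial (of_nat (2*k)) h x) / 2"

lemma bounded_linear_zeta1: "bounded_linear zeta1"
  unfolding linear_conv_bounded_linear[symmetric]
  by (rule linearI) (auto simp: zeta1_def complex_eq_iff)

lemma bounded_linear_zeta2: "bounded_linear zeta2"
  unfolding linear_conv_bounded_linear[symmetric]
  by (rule linearI) (auto simp: zeta2_def complex_eq_iff)

lemma partial_bounded_linear: "bounded_linear f \<Longrightarrow> partial j (\<lambda>x. f x - c) x = f (axis j 1)"
  by (rule partial_eq) (auto intro!: derivative_eq_intros bounded_linear_imp_has_derivative)

lemma dbar_zeta:
  assumes "k \<in> {1, 2}"
  shows "dbar k (\<lambda>x. zeta1 x - c) x = 0" "dbar k (\<lambda>x. zeta2 x - c) x = 0"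
  using assms unfolding dbar_def partial_bounded_linear[OF bounded_linear_zeta1]
    partial_bounded_linear[OF bounded_linear_zeta2]
  by (auto simp: zeta1_def zeta2_def axis_def complex_eq_iff)

section \<open>Multipliers and almost everywhere rules for the chosen derivatives\<close>

context bounded_open
begin

definition multiplier :: "fn \<Rightarrow> real \<Rightarrow> bool" where
  "multiplier h M \<longleftrightarrow> C1_on V h \<and> (\<forall>x\<in>V. cmod (h x) \<le> M) \<and> (\<forall>x\<in>V. \<forall>j. cmod (partial j h x) \<le> M)"

text \<open>\<open>closure V\<close> is compact, so continuity there bounds \<open>h\<close> and its
  partial derivatives. Smoothness on \<open>V\<close> alone would permit blow-up at the boundary;
  for this reason the common zero of z_1 and z_2 has to lie off the closure.\<close>

lemma multiplier_ex:
  assumes "C1_on S h" "closure V \<subseteq> S"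
  obtains M where "multiplier h M"
proof -
  have K: "compact (closure V)" using bdd by simp
  have c: "C1_on (closure V) h" using C1_on_subset[OF assms] .
  have "bounded (h ` closure V)"
    by (intro compact_imp_bounded compact_continuous_image C1_on_imp_continuous_on c K)
  then obtain A where A: "\<And>x. x \<in> V \<Longrightarrow> cmod (h x) \<le> A"
    unfolding bounded_iff using closure_subset[of V] by (auto simp: subset_iff)
  have "\<exists>B. \<forall>x\<in>V. cmod (partial j h x) \<le> B" for j
    using compact_imp_bounded[OF compact_continuous_image[OF C1_on_continuous_partial[OF c] K]]
      closure_subset[of V] unfolding bounded_iff by (meson image_eqI subsetD)
  then obtain B where B: "\<And>j x. x \<in> V \<Longrightarrow> cmod (partial j h x) \<le> B j" by metis
  have s: "\<bar>B j\<bar> \<le> (\<Sum>j\<in>UNIV. \<bar>B j\<bar>)" for j by (intro member_le_sum) auto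
  have s0: "0 \<le> (\<Sum>j\<in>UNIV. \<bar>B j\<bar>)" by (intro sum_nonneg) auto
  have "cmod (h x) \<le> \<bar>A\<bar> + (\<Sum>j\<in>UNIV. \<bar>B j\<bar>)" if "x \<in> V" for x
    using A[OF that] s0 by linarith
  moreover have "cmod (partial j h x) \<le> \<bar>A\<bar> + (\<Sum>j\<in>UNIV. \<bar>B j\<bar>)" if "x \<in> V" for x j
    using B[OF that, of j] s[of j] by linarith
  moreover have "C1_on V h" using c C1_on_subset closure_subset by blast
  ultimately show thesis using that unfolding multiplier_def by blast
qed

lemma multiplier_const: "multiplier (\<lambda>_. c) (cmod c)"
proof -
  have "partial j (\<lambda>_. c) x = 0" for j and x :: pt by (rule partial_eq[OF has_derivative_const])
  then show ?thesis by (simp add: multiplier_def)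
qed

lemma multiplierD:
  assumes "multiplier h M"
  shows "C1_on V h" "continuous_on V h" "continuous_on V (partial j h)"
    "\<And>x. x \<in> V \<Longrightarrow> cmod (h x) \<le> M" "\<And>x. x \<in> V \<Longrightarrow> cmod (partial j h x) \<le> M"
  using assms C1_on_imp_continuous_on C1_on_continuous_partial by (auto simp: multiplier_def)

lemma L2_multiplier:
  assumes "multiplier h M" "L2 V f"
  shows "L2 V (\<lambda>x. h x * f x)" "(L2norm V (\<lambda>x. h x * f x))\<^sup>2 \<le> M\<^sup>2 * (L2norm V f)\<^sup>2"
    "L2 V (\<lambda>x. partial j h x * f x)" "(L2norm V (\<lambda>x. partial j h x * f x))\<^sup>2 \<le> M\<^sup>2 * (L2norm V f)\<^sup>2"
  using L2_mult[OF assms(2) multiplierD(2)[OF assms(1)] multiplierD(4)[OF assms(1)]]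
    L2_mult[OF assms(2) multiplierD(3)[OF assms(1)] multiplierD(5)[OF assms(1)]] by auto

lemma L2_zero: "L2 V (\<lambda>_. 0)" by (rule L2_cont[where M=0]) auto

lemma W12_L2: "W12 V f \<Longrightarrow> L2 V f" by (simp add: W12_def)

lemma is_weak_deriv_wd: "W12 V f \<Longrightarrow> is_weak_deriv V j f (wd V j f)"
  unfolding W12_def wd_def by (metis someI_ex)

lemma L2_wd: "W12 V f \<Longrightarrow> L2 V (wd V j f)"
  using is_weak_deriv_wd by (auto simp: is_weak_deriv_def)

text \<open>Uniqueness renders the choice in \<open>wd\<close> harmless: a weak derivative found by
  computation may replace the chosen one.\<close>

lemma wd_AE:
  assumes "W12 V f" "is_weak_deriv V j f g"
  shows "AE x in lebesgue. x \<in> V \<longrightarrow> wd V j f x = g x"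
  using is_weak_deriv_unique[OF is_weak_deriv_wd[OF assms(1)] assms(2)] W12_L2[OF assms(1)] by simp

lemma wd_cong_AE:
  assumes "W12 V f" "W12 V g" "AE x in lebesgue. x \<in> V \<longrightarrow> f x = g x"
  shows "AE x in lebesgue. x \<in> V \<longrightarrow> wd V j f x = wd V j g x"
  by (rule is_weak_deriv_unique[OF is_weak_deriv_wd is_weak_deriv_wd]) (use assms W12_L2 in auto)

lemma W12_add:
  assumes "W12 V f" "W12 V g"
  shows "W12 V (\<lambda>x. f x + g x)"
    "AE x in lebesgue. x \<in> V \<longrightarrow> wd V j (\<lambda>x. f x + g x) x = wd V j f x + wd V j g x"
proof -
  have i: "is_weak_deriv V j (\<lambda>x. f x + g x) (\<lambda>x. wd V j f x + wd V j g x)" for j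
    using assms by (intro is_weak_deriv_add is_weak_deriv_wd W12_L2)
  show W: "W12 V (\<lambda>x. f x + g x)" using i L2_add(1) assms unfolding W12_def by blast
  show "AE x in lebesgue. x \<in> V \<longrightarrow> wd V j (\<lambda>x. f x + g x) x = wd V j f x + wd V j g x"
    by (rule wd_AE[OF W i])
qed

lemma W12_mult:
  assumes "multiplier h M" "W12 V f"
  shows "W12 V (\<lambda>x. h x * f x)"
    "AE x in lebesgue. x \<in> V \<longrightarrow> wd V j (\<lambda>x. h x * f x) x = h x * wd V j f x + partial j h x * f x"
proof -
  have i: "is_weak_deriv V j (\<lambda>x. h x * f x) (\<lambda>x. h x * wd V j f x + partial j h x * f x)" for j
    by (rule is_weak_deriv_mult[OF W12_L2[OF assms(2)] is_weak_deriv_wd[OF assms(2)]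
        multiplierD(1)[OF assms(1)] multiplierD(4)[OF assms(1)] multiplierD(5)[OF assms(1)]])
  show W: "W12 V (\<lambda>x. h x * f x)"
    using i L2_multiplier(1)[OF assms(1) W12_L2[OF assms(2)]] unfolding W12_def by blast
  show "AE x in lebesgue. x \<in> V \<longrightarrow> wd V j (\<lambda>x. h x * f x) x = h x * wd V j f x + partial j h x * f x"
    by (rule wd_AE[OF W i])
qed

lemma W12_const: "W12 V (\<lambda>_. c)"
  using is_weak_deriv_const[of _ c] L2_cont[of "\<lambda>_. c" "cmod c"] unfolding W12_def by auto

lemma L2_dzbar:
  assumes "W12 V f"
  shows "L2 V (dzbar V k f)" "(L2norm V (dzbar V k f))\<^sup>2 \<le> (W12norm V f)\<^sup>2"
proof -
  let ?p = "of_nat (2*k - 1) :: 4" and ?q = "of_nat (2*k) :: 4"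
  let ?S = "\<Sum>j\<in>UNIV. (L2norm V (wd V j f))\<^sup>2"
  let ?a = "\<lambda>x. (1/2) * wd V ?p f x" and ?b = "\<lambda>x. (\<i>/2) * wd V ?q f x"
  have eq: "dzbar V k f = (\<lambda>x. ?a x + ?b x)" by (auto simp: dzbar_def field_simps)
  note A = L2_multiplier(1,2)[OF multiplier_const[of "1/2"] L2_wd[OF assms, of ?p]]
  note B = L2_multiplier(1,2)[OF multiplier_const[of "\<i>/2"] L2_wd[OF assms, of ?q]]
  show "L2 V (dzbar V k f)" unfolding eq by (rule L2_add(1)[OF A(1) B(1)])
  have S: "(L2norm V (wd V j f))\<^sup>2 \<le> ?S" for j by (intro member_le_sum) auto
  have "(L2norm V (dzbar V k f))\<^sup>2 \<le> 2 * (L2norm V ?a)\<^sup>2 + 2 * (L2norm V ?b)\<^sup>2"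
    unfolding eq by (rule L2_add(2)[OF A(1) B(1)])
  \<comment> \<open>Each of the two terms is 2 * (1/4) times one summand of \<open>?S\<close> and is
    bounded by half of \<open>?S\<close> separately, so the indices need not be distinct; for
    \<open>k = 0\<close> they coincide.\<close>
  also have "\<dots> \<le> ?S" using A(2) B(2) S[of ?p] S[of ?q] by (simp add: norm_divide power_divide)
  also have "\<dots> \<le> (W12norm V f)\<^sup>2" by (simp add: W12norm_def add_nonneg_nonneg sum_nonneg)
  finally show "(L2norm V (dzbar V k f))\<^sup>2 \<le> (W12norm V f)\<^sup>2" .
qed

lemma dzbar_cong_AE:
  assumes "W12 V f" "W12 V g" "AE x in lebesgue. x \<in> V \<longrightarrow> f x = g x"
  shows "AE x in lebesgue. x \<in> V \<longrightarrow> dzbar V k f x = dzbar V k g x"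
  using wd_cong_AE[OF assms, of "of_nat (2*k - 1)"] wd_cong_AE[OF assms, of "of_nat (2*k)"]
  by eventually_elim (simp add: dzbar_def)

lemma dzbar_add_AE:
  assumes "W12 V f" "W12 V g"
  shows "AE x in lebesgue. x \<in> V \<longrightarrow> dzbar V k (\<lambda>x. f x + g x) x = dzbar V k f x + dzbar V k g x"
  using W12_add(2)[OF assms, of "of_nat (2*k - 1)"] W12_add(2)[OF assms, of "of_nat (2*k)"]
  by eventually_elim (simp add: dzbar_def field_simps)

text \<open>The term with \<open>dbar k h\<close> is the commutator of the Cauchy-Riemann operator
  with multiplication by \<open>h\<close>. It vanishes for the coordinate functions, but in general
  not for the g_j.\<close>

lemma dzbar_mult_AE:
  assumes "multiplier h M" "W12 V f"
  shows "AE x in lebesgue. x \<in> V \<longrightarrow> dzbar V k (\<lambda>x. h x * f x) x = h x * dzbar V k f x + dbar k h x * f x"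
  using W12_mult(2)[OF assms, of "of_nat (2*k - 1)"] W12_mult(2)[OF assms, of "of_nat (2*k)"]
  by eventually_elim (simp add: dzbar_def dbar_def field_simps)

lemma dzbar_zero_AE: "AE x in lebesgue. x \<in> V \<longrightarrow> dzbar V k (\<lambda>_. c) x = 0"
  using wd_AE[OF W12_const is_weak_deriv_const, of "of_nat (2*k - 1)" c]
    wd_AE[OF W12_const is_weak_deriv_const, of "of_nat (2*k)" c]
  by eventually_elim (simp add: dzbar_def)

lemma W12norm_sq: "(W12norm V f)\<^sup>2 = (L2norm V f)\<^sup>2 + (\<Sum>j\<in>UNIV. (L2norm V (wd V j f))\<^sup>2)"
  by (simp add: W12norm_def add_nonneg_nonneg sum_nonneg)

lemma Xnorm_sq: "(Xnorm V u)\<^sup>2 = (W12norm V (fst u))\<^sup>2 + (L2norm V (snd u))\<^sup>2"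
  by (simp add: Xnorm_def)

lemma Xnorm_nonneg: "0 \<le> Xnorm V u" by (simp add: Xnorm_def)

lemma W12norm_mult:
  assumes "multiplier h M" "W12 V f"
  shows "(W12norm V (\<lambda>x. h x * f x))\<^sup>2 \<le> 9 * M\<^sup>2 * (W12norm V f)\<^sup>2"
proof -
  have f: "L2 V f" by (rule W12_L2[OF assms(2)])
  have d: "(L2norm V (wd V j (\<lambda>x. h x * f x)))\<^sup>2 \<le> 2 * M\<^sup>2 * (L2norm V (wd V j f))\<^sup>2 + 2 * M\<^sup>2 * (L2norm V f)\<^sup>2" for j
  proof -
    note a = L2_multiplier(1,2)[OF assms(1) L2_wd[OF assms(2), of j]]
    note b = L2_multiplier(3,4)[OF assms(1) f, of j]
    have "L2norm V (wd V j (\<lambda>x. h x * f x)) = L2norm V (\<lambda>x. h x * wd V j f x + partial j h x * f x)"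
      by (rule L2_cong_AE[OF L2_wd[OF W12_mult(1)[OF assms]] L2_add(1)[OF a(1) b(1)] W12_mult(2)[OF assms]])
    then show ?thesis using L2_add(2)[OF a(1) b(1)] a(2) b(2) by simp
  qed
  have "(\<Sum>j\<in>UNIV. (L2norm V (wd V j (\<lambda>x. h x * f x)))\<^sup>2)
    \<le> (\<Sum>j\<in>UNIV. 2 * M\<^sup>2 * (L2norm V (wd V j f))\<^sup>2 + 2 * M\<^sup>2 * (L2norm V f)\<^sup>2)"
    by (intro sum_mono d)
  \<comment> \<open>The 8 is 2 for each of the four coordinates; the L^2 norm of the product itself
    adds 1, which gives the 9.\<close>
  also have "\<dots> = 2 * M\<^sup>2 * (\<Sum>j\<in>UNIV. (L2norm V (wd V j f))\<^sup>2) + 8 * M\<^sup>2 * (L2norm V f)\<^sup>2"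
    by (simp add: sum.distrib sum_distrib_left)
  finally have "(W12norm V (\<lambda>x. h x * f x))\<^sup>2 \<le>
      9 * (M\<^sup>2 * (L2norm V f)\<^sup>2) + 2 * (M\<^sup>2 * (\<Sum>j\<in>UNIV. (L2norm V (wd V j f))\<^sup>2))"
    using L2_multiplier(2)[OF assms(1) f] by (simp add: W12norm_sq)
  also have "\<dots> \<le> 9 * M\<^sup>2 * (W12norm V f)\<^sup>2"
    by (simp add: W12norm_sq distrib_left sum_nonneg)
  finally show ?thesis .
qed

section \<open>Boundedness, commutation and hyperinvariance on the direct sum\<close>

lemma Xcar_iff: "u \<in> Xcar V \<longleftrightarrow> W12 V (fst u) \<and> L2 V (snd u)"
  by (cases u) (simp add: Xcar_def)

lemma XZ_iff: "XZ V (u - v) \<longleftrightarrow> (AE x in lebesgue. x \<in> V \<longrightarrow> fst u x = fst v x) \<and>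
    (AE x in lebesgue. x \<in> V \<longrightarrow> snd u x = snd v x)"
  unfolding XZ_def eventually_conj_iff[symmetric]
  by (intro arg_cong[where f = "\<lambda>P. eventually P _"] ext) auto

lemma fst_add_fun: "fst (u + v :: xel) = (\<lambda>x. fst u x + fst v x)" by auto
lemma snd_add_fun: "snd (u + v :: xel) = (\<lambda>x. snd u x + snd v x)" by auto

lemma Xcar_add: "u \<in> Xcar V \<Longrightarrow> v \<in> Xcar V \<Longrightarrow> u + v \<in> Xcar V"
  unfolding Xcar_iff fst_add_fun snd_add_fun using W12_add(1) L2_add(1) by blast

lemma M_op_Xcar: "multiplier h M \<Longrightarrow> u \<in> Xcar V \<Longrightarrow> M_op h u \<in> Xcar V"
  unfolding Xcar_iff M_op_def fst_conv snd_conv using W12_mult(1) L2_multiplier(1) by blast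

lemma D_op_Xcar: "u \<in> Xcar V \<Longrightarrow> D_op V k u \<in> Xcar V"
  unfolding Xcar_iff D_op_def fst_conv snd_conv using W12_const L2_dzbar(1) by blast

lemma bounded_op_M_op:
  assumes h: "multiplier h M"
  shows "bounded_op Xsc (XZ V) (Xnorm V) (Xcar V) (M_op h)"
  unfolding bounded_op_def
proof (intro conjI ballI allI impI)
  show "M_op h x \<in> Xcar V" if "x \<in> Xcar V" for x by (rule M_op_Xcar[OF h that])
  show "XZ V (M_op h x - M_op h y)" if "XZ V (x - y)" for x y
    using that unfolding XZ_def by (rule eventually_mono) (auto simp: M_op_def)
  show "XZ V (M_op h (x + y) - (M_op h x + M_op h y))" for x y
    unfolding XZ_iff M_op_def by (simp add: distrib_left)
  show "XZ V (M_op h (Xsc c x) - Xsc c (M_op h x))" for c x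
    unfolding XZ_iff M_op_def Xsc_def by simp
  show "\<exists>K. \<forall>x\<in>Xcar V. Xnorm V (M_op h x) \<le> K * Xnorm V x"
  \<comment> \<open>The square root of the factor \<open>9 * M\<^sup>2\<close>; the absolute value
    appears because \<open>multiplier\<close> does not force M to be nonnegative when
    \<open>V\<close> is empty.\<close>
  proof (intro exI[of _ "3 * \<bar>M\<bar>"] ballI)
    fix u assume "u \<in> Xcar V"
    then have u: "W12 V (fst u)" "L2 V (snd u)" by (auto simp: Xcar_iff)
    have "(Xnorm V (M_op h u))\<^sup>2 \<le> 9 * M\<^sup>2 * (W12norm V (fst u))\<^sup>2 + M\<^sup>2 * (L2norm V (snd u))\<^sup>2"
      unfolding Xnorm_sq M_op_def fst_conv snd_conv
      using W12norm_mult[OF h u(1)] L2_multiplier(2)[OF h u(2)] by simp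
    also have "\<dots> \<le> (3 * \<bar>M\<bar> * Xnorm V u)\<^sup>2"
      by (simp add: power_mult_distrib Xnorm_sq distrib_left)
    finally show "Xnorm V (M_op h u) \<le> 3 * \<bar>M\<bar> * Xnorm V u"
      by (rule power2_le_imp_le) (simp add: Xnorm_nonneg)
  qed
qed

lemma bounded_op_D_op: "bounded_op Xsc (XZ V) (Xnorm V) (Xcar V) (D_op V k)"
  unfolding bounded_op_def
proof (intro conjI ballI allI impI)
  show "D_op V k x \<in> Xcar V" if "x \<in> Xcar V" for x by (rule D_op_Xcar[OF that])
  show "XZ V (D_op V k x - D_op V k y)" if "XZ V (x - y)" "x \<in> Xcar V" "y \<in> Xcar V" for x y
    using that dzbar_cong_AE[of "fst x" "fst y" k] unfolding XZ_iff D_op_def Xcar_iff by simp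
  show "XZ V (D_op V k (x + y) - (D_op V k x + D_op V k y))" if "x \<in> Xcar V" "y \<in> Xcar V" for x y
    using that dzbar_add_AE[of "fst x" "fst y" k]
    unfolding XZ_iff D_op_def Xcar_iff fst_add_fun snd_add_fun by simp
  show "XZ V (D_op V k (Xsc c x) - Xsc c (D_op V k x))" if "x \<in> Xcar V" for c x
  proof -
    have "dbar k (\<lambda>_. c) y = 0" for y
      unfolding dbar_def by (simp add: partial_eq[OF has_derivative_const])
    then show ?thesis
      using that dzbar_mult_AE[OF multiplier_const[of c], of "fst x" k]
      unfolding XZ_iff D_op_def Xcar_iff Xsc_def by simp
  qed
  show "\<exists>K. \<forall>x\<in>Xcar V. Xnorm V (D_op V k x) \<le> K * Xnorm V x"
  proof (intro exI[of _ 1] ballI)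
    fix u assume "u \<in> Xcar V"
    then have u: "W12 V (fst u)" by (auto simp: Xcar_iff)
    \<comment> \<open>The derivative chosen for the zero function is zero only almost everywhere, so
      the vanishing of its norm needs an argument.\<close>
    have "L2norm V (wd V j (\<lambda>_. 0)) = L2norm V (\<lambda>_. 0)" for j
      by (rule L2_cong_AE[OF L2_wd[OF W12_const] L2_zero wd_AE[OF W12_const is_weak_deriv_const]])
    moreover have "L2norm V (\<lambda>_. 0) = 0" by (simp add: L2norm_def)
    ultimately have "(W12norm V (\<lambda>_. 0))\<^sup>2 = 0" by (simp add: W12norm_sq)
    then have "(Xnorm V (D_op V k u))\<^sup>2 \<le> (W12norm V (fst u))\<^sup>2"
      unfolding Xnorm_sq D_op_def fst_conv snd_conv using L2_dzbar(2)[OF u, of k] by simp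
    also have "\<dots> \<le> (1 * Xnorm V u)\<^sup>2" by (simp add: Xnorm_sq)
    finally show "Xnorm V (D_op V k u) \<le> 1 * Xnorm V u"
      by (rule power2_le_imp_le) (simp add: Xnorm_nonneg)
  qed
qed

text \<open>A pairwise commuting class that contains the A_i and also their shifts by the chosen
  spectral point, whose last two coordinates are 0. Boundedness and commutation are thus checked
  once for both tuples.\<close>

definition holo_op :: "(xel \<Rightarrow> xel) \<Rightarrow> bool" where
  "holo_op T \<longleftrightarrow> (\<exists>h M. multiplier h M \<and> (\<forall>x. \<forall>k\<in>{1, 2}. dbar k h x = 0) \<and> T = M_op h) \<or>
     (\<exists>k\<in>{1, 2}. T = D_op V k)"

lemma holo_op_bounded: "holo_op T \<Longrightarrow> bounded_op Xsc (XZ V) (Xnorm V) (Xcar V) T"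
  unfolding holo_op_def using bounded_op_M_op bounded_op_D_op by blast

lemma M_op_D_op_commute:
  assumes "multiplier h M" "\<And>x. dbar k h x = 0" "u \<in> Xcar V"
  shows "XZ V (M_op h (D_op V k u) - D_op V k (M_op h u))"
  using assms dzbar_mult_AE[OF assms(1), of "fst u" k]
  unfolding XZ_iff D_op_def M_op_def Xcar_iff by (auto elim!: eventually_mono)

lemma XZ_commute: "XZ V (u - v) \<Longrightarrow> XZ V (v - u)"
  unfolding XZ_def by (rule eventually_mono) auto

lemma XZ_0: "XZ V 0" by (simp add: XZ_def)

text \<open>A product of two Cauchy-Riemann operators is null in either order, since the inner one
  has first component 0. A mixed pair commutes because the multiplier is holomorphic.\<close>

lemma holo_op_commute:
  assumes "holo_op S" "holo_op T" "u \<in> Xcar V"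
  shows "XZ V (S (T u) - T (S u))"
proof -
  have MM: "XZ V (M_op h (M_op h' u) - M_op h' (M_op h u))" for h h'
    by (simp add: M_op_def mult.left_commute XZ_0)
  have DD: "XZ V (D_op V k (D_op V l u) - D_op V l (D_op V k u))" for k l
    using dzbar_zero_AE[of k 0] dzbar_zero_AE[of l 0]
    unfolding XZ_iff D_op_def by (auto elim: eventually_elim2)
  from assms(1,2) show ?thesis
    unfolding holo_op_def
  proof (elim disjE exE bexE conjE)
    fix h M k assume "multiplier h M" "\<forall>x. \<forall>k\<in>{1, 2}. dbar k h x = 0" "S = M_op h" "k \<in> {1, 2}" "T = D_op V k"
    then show ?thesis using M_op_D_op_commute[of h M k u] assms(3) by auto
  next
    fix h M k assume "multiplier h M" "\<forall>x. \<forall>k\<in>{1, 2}. dbar k h x = 0" "T = M_op h" "k \<in> {1, 2}" "S = D_op V k"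
    then show ?thesis using XZ_commute[OF M_op_D_op_commute[of h M k u]] assms(3) by auto
  qed (use MM DD in auto)
qed

lemma holo_op_zeta:
  "holo_op (M_op (\<lambda>x. zeta1 x - c))" "holo_op (M_op (\<lambda>x. zeta2 x - c))"
proof -
  have C: "C1_on UNIV (\<lambda>x. zeta1 x - c)" "C1_on UNIV (\<lambda>x. zeta2 x - c)"
    by (intro C1_on_diff C1_on_const C1_on_bounded_linear bounded_linear_zeta1 bounded_linear_zeta2)+
  obtain M1 where "multiplier (\<lambda>x. zeta1 x - c) M1" using multiplier_ex[OF C(1)] by blast
  moreover obtain M2 where "multiplier (\<lambda>x. zeta2 x - c) M2" using multiplier_ex[OF C(2)] by blast
  ultimately show "holo_op (M_op (\<lambda>x. zeta1 x - c))" "holo_op (M_op (\<lambda>x. zeta2 x - c))"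
    unfolding holo_op_def using dbar_zeta by blast+
qed

lemma Aop_eq: "Aop V i = (if i = 0 then M_op zeta1 else if i = 1 then M_op zeta2
    else if i = 2 then D_op V 1 else D_op V 2)"
  by (auto simp: Aop_def M_op_def D_op_def)

lemma holo_op_Aop: "holo_op (Aop V i)"
  using holo_op_zeta[of 0] unfolding Aop_eq by (simp add: holo_op_def)

lemma bounded_op_Aop: "bounded_op Xsc (XZ V) (Xnorm V) (Xcar V) (Aop V i)"
  by (intro holo_op_bounded holo_op_Aop)

lemma commuting_tuple_Aop: "commuting_tuple (XZ V) (Xcar V) (Aop V) n"
  unfolding commuting_tuple_def by (intro allI ballI impI holo_op_commute holo_op_Aop)

lemma hyperinvariant_X1car: "hyperinvariant Xsc (XZ V) (Xnorm V) (Xcar V) (Aop V) 4 (X1car V)"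
  unfolding hyperinvariant_def
proof (intro conjI allI impI ballI)
  show "X1car V \<subseteq> Xcar V" by (auto simp: X1car_def)
  fix B u
  assume B: "bounded_op Xsc (XZ V) (Xnorm V) (Xcar V) B \<and>
      (\<forall>i<4. \<forall>x\<in>Xcar V. XZ V (B (Aop V i x) - Aop V i (B x)))" and "u \<in> X1car V"
  then have u: "u \<in> Xcar V" "XZ V (Aop V 2 u)" "XZ V (Aop V 3 u)" by (auto simp: X1car_def)
  have z: "(0::xel) \<in> Xcar V"
    unfolding Xcar_iff using W12_const[of 0] L2_zero by (simp add: zero_prod_def zero_fun_def)
  \<comment> \<open>A bounded operator respects the linear structure only modulo null elements, so
    \<open>B 0\<close> need not be 0 itself; homogeneity with the scalar 0 shows that it is
    null.\<close>
  have B0: "XZ V (B 0)"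
  proof -
    have "Xsc 0 0 = (0::xel)" by (simp add: Xsc_def zero_prod_def zero_fun_def)
    moreover have "XZ V (B (Xsc 0 0) - Xsc 0 (B 0))" using B z unfolding bounded_op_def by blast
    moreover have "Xsc 0 (B 0) = 0" by (simp add: Xsc_def zero_prod_def zero_fun_def)
    ultimately show ?thesis by simp
  qed
  have "XZ V (Aop V i (B u))" if i: "i < 4" "XZ V (Aop V i u)" for i
  proof -
    have "Aop V i u \<in> Xcar V" using bounded_op_Aop u(1) unfolding bounded_op_def by blast
    then have 1: "XZ V (B (Aop V i u) - B 0)" using B z i(2) unfolding bounded_op_def by auto
    have 2: "XZ V (B (Aop V i u) - Aop V i (B u))" using B i(1) u(1) by blast
    from 1 2 B0 show ?thesis unfolding XZ_def by eventually_elim auto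
  qed
  then show "B u \<in> X1car V" using u B unfolding X1car_def bounded_op_def by simp
qed

end

section \<open>Regularity at points off the closure\<close>

lemma C1_on_cmod_sq:
  assumes "C1_on S z" shows "C1_on S (\<lambda>x. (cmod (z x))\<^sup>2)"
  unfolding cmod_power2 unfolding power2_eq_square
  by (intro C1_on_add C1_on_mult C1_on_bounded_linear_compose[OF bounded_linear_Re assms]
      C1_on_bounded_linear_compose[OF bounded_linear_Im assms])

lemma C1_on_zeta: "C1_on S (\<lambda>x. zeta1 x - c)" "C1_on S (\<lambda>x. zeta2 x - c)"
  by (intro C1_on_diff C1_on_const C1_on_bounded_linear bounded_linear_zeta1 bounded_linear_zeta2)+

definition spec_point :: "complex \<Rightarrow> complex \<Rightarrow> nat \<Rightarrow> complex" where
  "spec_point a1 a2 i = (if i = 0 then a1 else if i = 1 then a2 else 0)"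

context bounded_open
begin

lemma koszul_tuple_holo_op:
  assumes "\<And>i. holo_op (S i)" shows "koszul_tuple (XZ V) (Xcar V) S"
proof
  have b: "bounded_op Xsc (XZ V) (Xnorm V) (Xcar V) (S i)" for i
    by (rule holo_op_bounded[OF assms])
  show "XZ V 0" by (rule XZ_0)
  show "XZ V (x + y)" if "XZ V x" "XZ V y" for x y
    using that unfolding XZ_def by (rule eventually_elim2) auto
  show "XZ V (- x)" if "XZ V x" for x
    using that unfolding XZ_def by (rule eventually_mono) auto
  show "0 \<in> Xcar V"
    unfolding Xcar_iff using W12_const[of 0] L2_zero by (simp add: zero_prod_def zero_fun_def)
  show "x + y \<in> Xcar V" if "x \<in> Xcar V" "y \<in> Xcar V" for x y by (rule Xcar_add[OF that])
  show "- x \<in> Xcar V" if "x \<in> Xcar V" for x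
  proof -
    have "- x = M_op (\<lambda>_. - 1) x" by (auto simp: M_op_def uminus_prod_def)
    then show ?thesis using M_op_Xcar[OF multiplier_const that] by simp
  qed
  show "S i x \<in> Xcar V" if "x \<in> Xcar V" for i x using b that unfolding bounded_op_def by blast
  show "XZ V (S i x - S i y)" if "x \<in> Xcar V" "y \<in> Xcar V" "XZ V (x - y)" for i x y
    using b that unfolding bounded_op_def by blast
  show "XZ V (S i (x + y) - (S i x + S i y))" if "x \<in> Xcar V" "y \<in> Xcar V" for i x y
    using b that unfolding bounded_op_def by blast
  show "XZ V (S i (S j x) - S j (S i x))" if "x \<in> Xcar V" for i j x
    by (rule holo_op_commute[OF assms assms that])
qed

lemma shifted_Aop:
  "(\<lambda>i v. Aop V i v - Xsc (spec_point a1 a2 i) v) =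
   (\<lambda>i. if i = 0 then M_op (\<lambda>x. zeta1 x - a1) else if i = 1 then M_op (\<lambda>x. zeta2 x - a2)
     else if i = 2 then D_op V 1 else D_op V 2)"
  by (intro ext) (auto simp: Aop_eq spec_point_def M_op_def D_op_def Xsc_def left_diff_distrib
      zero_prod_def zero_fun_def fun_eq_iff)

lemma koszul_tuple_shifted: "koszul_tuple (XZ V) (Xcar V) (\<lambda>i v. Aop V i v - Xsc (spec_point a1 a2 i) v)"
  unfolding shifted_Aop by (rule koszul_tuple_holo_op) (auto simp: holo_op_zeta holo_op_def[of "D_op _ _"])

section \<open>Exactness for a pair of multiplications whose symbols generate 1\<close>

lemma exact_at_2_of_right_inverse:
  assumes g: "multiplier g0 M0" "multiplier g1 M1"
    and kt: "koszul_tuple (XZ V) (Xcar V) S" and S: "S 0 = M_op s0" "S 1 = M_op s1"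
    and one: "\<And>x. x \<in> V \<Longrightarrow> g0 x * s0 x + g1 x * s1 x = 1" and k: "k \<le> 2"
  shows "koszul_tuple.exact_at (XZ V) (Xcar V) S 2 k"
proof -
  interpret koszul_tuple "XZ V" "Xcar V" S by fact
  note S = S S(2)[unfolded One_nat_def]
  have kd0: "kd 2 \<eta> {} = M_op s0 (\<eta> {0}) + M_op s1 (\<eta> {1})" for \<eta>
  proof -
    have "{i. i < (2::nat) \<and> i \<notin> {}} = {0, 1}" by auto
    then show ?thesis by (simp add: kd_def sgn_op_def S)
  qed
  have kd1: "kd 2 \<eta> {0} = - M_op s1 (\<eta> {0, 1})" for \<eta>
  proof -
    have "{i. i < (2::nat) \<and> i \<notin> {0}} = {1}" "{j \<in> {0::nat}. j < 1} = {0}" by auto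
    then show ?thesis by (simp add: kd_def sgn_op_def S insert_commute)
  qed
  have kd2: "kd 2 \<eta> {1} = M_op s0 (\<eta> {0, 1})" for \<eta>
  proof -
    have "{i. i < (2::nat) \<and> i \<notin> {1}} = {0}" "{j \<in> {1::nat}. j < 0} = {}" by auto
    then show ?thesis by (simp add: kd_def sgn_op_def S)
  qed
  have lt2: "{..<2::nat} = {0, 1}" by auto
  have J1: "J = {0} \<or> J = {1}" if J: "J \<subseteq> {..<2}" "card J = 1" for J :: "nat set"
  proof -
    obtain t where "J = {t}" using card_1_singletonE[OF J(2)] .
    with J(1) show ?thesis unfolding lt2 by simp
  qed
  have J2: "J = {0, 1}" if "J \<subseteq> {..<2}" "card J = 2" for J :: "nat set"
    using card_subset_eq[OF _ that(1)] that(2) by (simp add: lt2)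
  consider "k = 0" | "k = 1" | "k = 2" using k by linarith
  then show ?thesis
  proof cases
    case 1
    show ?thesis unfolding exact_at_def 1
    proof (intro ballI impI)
      fix \<omega> assume "\<omega> \<in> forms 2 0"
      then have w: "\<omega> {} \<in> Xcar V" by (auto simp: forms_def)
      let ?\<eta> = "\<lambda>K. if K = {0::nat} then M_op g0 (\<omega> {}) else M_op g1 (\<omega> {})"
      have "?\<eta> \<in> forms 2 (Suc 0)" using M_op_Xcar[OF g(1) w] M_op_Xcar[OF g(2) w] by (auto simp: forms_def)
      moreover have "eqv (kd 2 ?\<eta> {}) (\<omega> {})"
      proof -
        have "s0 x * (g0 x * t) + s1 x * (g1 x * t) = t" if "x \<in> V" for x t
        proof -
          have "s0 x * (g0 x * t) + s1 x * (g1 x * t) = (g0 x * s0 x + g1 x * s1 x) * t"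
            by (simp add: algebra_simps)
          then show ?thesis using one[OF that] by simp
        qed
        then show ?thesis unfolding kd0 eqv_def XZ_iff by (intro conjI AE_I2) (auto simp: M_op_def)
      qed
      ultimately show "\<exists>\<eta>\<in>forms 2 (Suc 0). \<forall>J. J \<subseteq> {..<2} \<and> card J = 0 \<longrightarrow> eqv (kd 2 \<eta> J) (\<omega> J)"
        by (intro bexI[of _ ?\<eta>]) (auto simp: card_eq_0_iff dest: finite_subset)
    qed
  next
    case 2
    show ?thesis unfolding exact_at_def 2
    proof (intro ballI impI)
      fix \<omega> assume w: "\<omega> \<in> forms 2 1"
        and cl: "1 = (0::nat) \<or> (\<forall>J. J \<subseteq> {..<2} \<and> card J = 1 - 1 \<longrightarrow> eqv (kd 2 \<omega> J) (0))"
      have c: "\<omega> {0} \<in> Xcar V" "\<omega> {1} \<in> Xcar V" using w by (auto simp: forms_def)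
      \<comment> \<open>Since \<open>s0 u + s1 v = 0\<close> and \<open>g0 s0 + g1 s1 = 1\<close>, the element \<open>e = g0 v - g1 u\<close> satisfies
        \<open>s0 e = v\<close> and \<open>- s1 e = u\<close>.\<close>
      define e where "e = M_op g0 (\<omega> {1}) - M_op g1 (\<omega> {0})"
      have eC: "e \<in> Xcar V" unfolding e_def by (intro C_diff M_op_Xcar[OF g(1)] M_op_Xcar[OF g(2)] c)
      have "eqv (kd 2 \<omega> {}) (0)" using cl by simp
      then have z: "AE x in lebesgue. x \<in> V \<longrightarrow> s0 x * fst (\<omega> {0}) x + s1 x * fst (\<omega> {1}) x = 0 \<and>
          s0 x * snd (\<omega> {0}) x + s1 x * snd (\<omega> {1}) x = 0"
        unfolding kd0 eqv_def XZ_def by (auto simp: M_op_def)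
      have a: "s0 x * (g0 x * v - g1 x * u) = v" "- (s1 x * (g0 x * v - g1 x * u)) = u"
        if "x \<in> V" "s0 x * u + s1 x * v = 0" for x u v
        using one[OF that(1)] that(2) by algebra+
      have 0: "eqv (kd 2 (\<lambda>_. e) {0}) (\<omega> {0})"
        using z unfolding kd1 eqv_def XZ_def
        by (rule eventually_mono) (use a in \<open>auto simp: M_op_def e_def\<close>)
      have 1: "eqv (kd 2 (\<lambda>_. e) {1}) (\<omega> {1})"
        using z unfolding kd2 eqv_def XZ_def
        by (rule eventually_mono) (use a in \<open>auto simp: M_op_def e_def\<close>)
      show "\<exists>\<eta>\<in>forms 2 (Suc 1). \<forall>J. J \<subseteq> {..<2} \<and> card J = 1 \<longrightarrow> eqv (kd 2 \<eta> J) (\<omega> J)"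
        using 0 1 J1 eC by (intro bexI[of _ "\<lambda>_. e"]) (auto simp: forms_def)
    qed
  next
    case 3
    show ?thesis unfolding exact_at_def 3
    proof (intro ballI impI)
      fix \<omega> assume w: "\<omega> \<in> forms 2 2"
        and cl: "2 = (0::nat) \<or> (\<forall>J. J \<subseteq> {..<2} \<and> card J = 2 - 1 \<longrightarrow> eqv (kd 2 \<omega> J) (0))"
      have "eqv (kd 2 \<omega> {0}) (0)" "eqv (kd 2 \<omega> {1}) (0)" using cl by auto
      then have "AE x in lebesgue. x \<in> V \<longrightarrow> fst (\<omega> {0, 1}) x = 0 \<and> snd (\<omega> {0, 1}) x = 0"
        unfolding kd1 kd2 eqv_def XZ_def
      proof eventually_elim
        case (elim x)
        \<comment> \<open>Multiplying the relation g0 s0 + g1 s1 = 1 by \<open>u\<close> gives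
          \<open>u\<close> on one side and 0 on the other.\<close>
        have "u = 0" if "x \<in> V" "s1 x * u = 0" "s0 x * u = 0" for u
          using one[OF that(1)] that(2,3) by algebra
        moreover have "s1 x * fst (\<omega> {0, 1}) x = 0" "s0 x * fst (\<omega> {0, 1}) x = 0"
          "s1 x * snd (\<omega> {0, 1}) x = 0" "s0 x * snd (\<omega> {0, 1}) x = 0" if "x \<in> V"
          using elim that by (simp_all add: M_op_def)
        ultimately show ?case by blast
      qed
      then have wz: "eqv 0 (\<omega> {0, 1})" unfolding eqv_def XZ_def by (rule eventually_mono) auto
      have kz: "kd 2 (\<lambda>_. 0) {0, 1} = 0"
      proof -
        have e: "{i. i < (2::nat) \<and> i \<notin> {0, 1}} = {}" by auto
        show ?thesis unfolding kd_def e by simp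
      qed
      show "\<exists>\<eta>\<in>forms 2 (Suc 2). \<forall>J. J \<subseteq> {..<2} \<and> card J = 2 \<longrightarrow> eqv (kd 2 \<eta> J) (\<omega> J)"
      proof (intro bexI[of _ "\<lambda>_. 0"] allI impI)
        fix J :: "nat set" assume "J \<subseteq> {..<2} \<and> card J = 2"
        then have J: "J = {0, 1}" using J2 by blast
        show "eqv (kd 2 (\<lambda>_. 0) J) (\<omega> J)" unfolding J by (simp only: kz wz)
      qed (simp add: forms_def C_0)
    qed
  qed
qed

text \<open>The denominator of the g_j has no zero on \<open>Q\<close>, and \<open>Q\<close>
  contains the closure of \<open>V\<close>; so the g_j are multipliers in the sense required,
  although they would be singular at the common zero of z_1 and z_2.\<close>

lemma taylor_regular_off_closure:
  assumes off: "\<And>x. x \<in> closure V \<Longrightarrow> zeta1 x \<noteq> a1 \<or> zeta2 x \<noteq> a2"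
  shows "taylor_regular Xsc (XZ V) (Xcar V) (Aop V) 4 (spec_point a1 a2)"
proof -
  define Q where "Q = {x. zeta1 x \<noteq> a1 \<or> zeta2 x \<noteq> a2}"
  let ?n = "\<lambda>x. (cmod (zeta1 x - a1))\<^sup>2 + (cmod (zeta2 x - a2))\<^sup>2"
  have pos: "?n x \<noteq> 0" if "x \<in> Q" for x
    using that by (auto simp: Q_def add_nonneg_eq_0_iff)
  have inv: "C1_on Q (\<lambda>x. inverse (?n x))"
  proof (rule C1_on_real_compose[where F = inverse and g = ?n and F' = "\<lambda>t. - (inverse t ^ Suc (Suc 0))"])
    show "C1_on Q ?n" by (intro C1_on_add C1_on_cmod_sq C1_on_zeta)
    show "(inverse has_real_derivative - (inverse (?n x) ^ Suc (Suc 0))) (at (?n x))" if "x \<in> Q" for x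
      by (rule DERIV_inverse[OF pos[OF that]])
    show "continuous_on (?n ` Q) (\<lambda>t. - (inverse t ^ Suc (Suc 0)))"
      using pos by (intro continuous_intros) auto
  qed
  let ?g0 = "\<lambda>x. cnj (zeta1 x - a1) * of_real (inverse (?n x))"
  let ?g1 = "\<lambda>x. cnj (zeta2 x - a2) * of_real (inverse (?n x))"
  have C: "C1_on Q ?g0" "C1_on Q ?g1"
    by (intro C1_on_mult C1_on_of_real[OF inv] C1_on_bounded_linear_compose[OF bounded_linear_cnj] C1_on_zeta)+
  have QV: "closure V \<subseteq> Q" using off by (auto simp: Q_def)
  obtain M0 where g0: "multiplier ?g0 M0" by (rule multiplier_ex[OF C(1) QV])
  obtain M1 where g1: "multiplier ?g1 M1" by (rule multiplier_ex[OF C(2) QV])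
  have one: "?g0 x * (zeta1 x - a1) + ?g1 x * (zeta2 x - a2) = 1" if "x \<in> V" for x
  proof -
    have nz: "?n x \<noteq> 0" using pos QV closure_subset that by blast
    have "complex_of_real (?n x) * of_real (inverse (?n x)) = 1"
      unfolding of_real_mult[symmetric] right_inverse[OF nz] by simp
    moreover have "complex_of_real (?n x) = cnj (zeta1 x - a1) * (zeta1 x - a1) + cnj (zeta2 x - a2) * (zeta2 x - a2)"
      by (simp only: of_real_add complex_norm_square mult.commute)
    ultimately show ?thesis by algebra
  qed
  interpret koszul_tuple "XZ V" "Xcar V" "\<lambda>i v. Aop V i v - Xsc (spec_point a1 a2 i) v"
    by (rule koszul_tuple_shifted)
  have "exact_at 2 k" if "k \<le> 2" for k
    by (rule exact_at_2_of_right_inverse[OF g0 g1 koszul_tuple_shifted _ _ one that])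
      (simp_all add: shifted_Aop[THEN fun_cong])
  \<comment> \<open>The two Cauchy-Riemann operators are adjoined by the mapping cone argument; of
    them only commutation with the pair and with each other is used.\<close>
  then have "exact_at 4 k" if "k \<le> 4" for k
    using that by (intro exact_at_mono[of 2 4]) auto
  then show ?thesis
    by (subst taylor_regular_iff_exact_at[OF koszul_tuple_shifted]) blast
qed

text \<open>By the definition of the weak derivatives, the Cauchy-Riemann operator moves from the
  test function to \<open>f\<close> with a change of sign, and there it gives zero.\<close>

lemma integral_dbar_test_fun_eq_0:
  assumes f: "W12 V f" and hol: "AE x in lebesgue. x \<in> V \<longrightarrow> dzbar V k f x = 0" and \<phi>: "test_fun V \<phi>"
  shows "set_lebesgue_integral lebesgue V (\<lambda>x. f x * dbar k \<phi> x) = 0"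
    "set_integrable lebesgue V (\<lambda>x. f x * dbar k \<phi> x)"
proof -
  let ?p = "of_nat (2*k - 1) :: 4" and ?q = "of_nat (2*k) :: 4"
  note I = set_integrable_test[OF W12_L2[OF f] \<phi>]
  have W: "(LINT x:V|lebesgue. wd V j f x * \<phi> x) = - (LINT x:V|lebesgue. f x * partial j \<phi> x)" for j
    using is_weak_deriv_wd[OF f] \<phi> unfolding is_weak_deriv_def by blast
  note J = set_integrable_test(1)[OF L2_wd[OF f] \<phi>]
  have e1: "(\<lambda>x. f x * dbar k \<phi> x) = (\<lambda>x. (1/2) * (f x * partial ?p \<phi> x) + (\<i>/2) * (f x * partial ?q \<phi> x))"
    by (auto simp: dbar_def field_simps)
  have i1: "set_integrable lebesgue V (\<lambda>x. (1/2) * (f x * partial ?p \<phi> x))"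
    "set_integrable lebesgue V (\<lambda>x. (\<i>/2) * (f x * partial ?q \<phi> x))"
    using I(2) by (intro set_integrable_mult_right; blast)+
  have i2: "set_integrable lebesgue V (\<lambda>x. (1/2) * (wd V ?p f x * \<phi> x))"
    "set_integrable lebesgue V (\<lambda>x. (\<i>/2) * (wd V ?q f x * \<phi> x))"
    using J by (intro set_integrable_mult_right; blast)+
  show "set_integrable lebesgue V (\<lambda>x. f x * dbar k \<phi> x)" unfolding e1 by (rule set_integral_add(1)[OF i1])
  have "(LINT x:V|lebesgue. f x * dbar k \<phi> x)
    = - (LINT x:V|lebesgue. (1/2) * (wd V ?p f x * \<phi> x) + (\<i>/2) * (wd V ?q f x * \<phi> x))"
    unfolding e1 set_integral_add(2)[OF i1] set_integral_add(2)[OF i2] set_integral_mult_right W by simp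
  also have "(LINT x:V|lebesgue. (1/2) * (wd V ?p f x * \<phi> x) + (\<i>/2) * (wd V ?q f x * \<phi> x)) = 0"
    unfolding set_lebesgue_integral_def
  proof (rule integral_eq_zero_AE)
    show "AE x in lebesgue. indicator V x *\<^sub>R ((1/2) * (wd V ?p f x * \<phi> x) + (\<i>/2) * (wd V ?q f x * \<phi> x)) = 0"
      using hol
    proof eventually_elim
      case (elim x)
      have "(1/2) * (wd V ?p f x * \<phi> x) + (\<i>/2) * (wd V ?q f x * \<phi> x) = dzbar V k f x * \<phi> x"
        by (simp add: dzbar_def field_simps)
      then show ?case using elim by (auto simp: indicator_def)
    qed
  qed
  finally show "(LINT x:V|lebesgue. f x * dbar k \<phi> x) = 0" by simp
qed

end

section \<open>Radial bump functions and polydiscs\<close>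

text \<open>With u = (t - \<alpha>)/\<delta>, the choice is P = -(1 - u_+^3)_+^3, where the
  subscript denotes the positive part. The cubes leave squares in P', so b is again continuously
  differentiable; the factor 9/\<delta> is 3 * 3 * (1/\<delta>) from the chain rule. To the left of
  \<alpha> the primitive is the constant -1, so only its vanishing to the right of \<beta> is
  available.\<close>

lemma C1_bump_exists:
  fixes \<alpha> \<beta> :: real
  assumes "\<alpha> < \<beta>"
  obtains P b b' where "\<And>t. (P has_real_derivative b t) (at t)" "\<And>t. (b has_real_derivative b' t) (at t)"
    "continuous_on UNIV b'" "continuous_on UNIV b" "\<And>t. t \<le> \<alpha> \<Longrightarrow> b t = 0" "\<And>t. t \<ge> \<beta> \<Longrightarrow> b t = 0" "\<And>t. t \<ge> \<beta> \<Longrightarrow> P t = 0"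
    "\<And>t. 0 \<le> b t" "\<And>t. \<alpha> < t \<Longrightarrow> t < \<beta> \<Longrightarrow> 0 < b t"
proof -
  define \<delta> where "\<delta> = \<beta> - \<alpha>"
  have \<delta>: "\<delta> > 0" using assms by (simp add: \<delta>_def)
  let ?m = "\<lambda>t::real. max 0 t"
  define u where "u t = (t - \<alpha>) / \<delta>" for t
  define w where "w t = 1 - (?m (u t)) ^ 3" for t
  define P where "P t = - ((?m (w t)) ^ 3)" for t
  define b where "b t = (9 / \<delta>) * ((?m (w t))\<^sup>2 * (?m (u t))\<^sup>2)" for t
  define b' where "b' t = (9 / \<delta>) * ((?m (w t))\<^sup>2 * (2 * ?m (u t) * (1 / \<delta>)) +
      (2 * ?m (w t) * (- (3 * (?m (u t))\<^sup>2 * (1 / \<delta>)))) * (?m (u t))\<^sup>2)" for t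
  have du: "(u has_real_derivative 1 / \<delta>) (at t)" for t
    unfolding u_def[abs_def] using \<delta> by (auto intro!: derivative_eq_intros)
  have m2: "((\<lambda>t. (?m t)\<^sup>2) has_real_derivative 2 * ?m t) (at t)" for t
    using has_derivative_max0_power[of 2 t] by simp
  have m3: "((\<lambda>t. (?m t) ^ 3) has_real_derivative 3 * (?m t)\<^sup>2) (at t)" for t
    using has_derivative_max0_power[of 3 t] by (simp add: numeral_3_eq_3 numeral_2_eq_2)
  have du2: "((\<lambda>t. (?m (u t))\<^sup>2) has_real_derivative 2 * ?m (u t) * (1 / \<delta>)) (at t)" for t
    by (rule DERIV_chain2[OF m2 du])
  have dw: "(w has_real_derivative - (3 * (?m (u t))\<^sup>2 * (1 / \<delta>))) (at t)" for t
    unfolding w_def[abs_def] using DERIV_diff[OF DERIV_const DERIV_chain2[OF m3 du], of 1 t] by simp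
  have dw2: "((\<lambda>t. (?m (w t))\<^sup>2) has_real_derivative 2 * ?m (w t) * (- (3 * (?m (u t))\<^sup>2 * (1 / \<delta>)))) (at t)" for t
    by (rule DERIV_chain2[OF m2 dw])
  have cu: "continuous_on UNIV u" unfolding u_def[abs_def] using \<delta> by (intro continuous_intros) auto
  have cw: "continuous_on UNIV w" unfolding w_def[abs_def] by (intro continuous_intros cu)
  have u1: "1 \<le> u t" if "t \<ge> \<beta>" for t using that \<delta> by (simp add: u_def \<delta>_def field_simps)
  have w0: "?m (w t) = 0" if "t \<ge> \<beta>" for t
  proof -
    have "1 \<le> (?m (u t)) ^ 3" using u1[OF that] by (intro one_le_power) simp
    then show ?thesis by (simp add: w_def)
  qed
  show thesis
  proof (rule that[of P b b'])
    show "(P has_real_derivative b t) (at t)" for t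
    proof -
      have "(P has_real_derivative - (3 * (?m (w t))\<^sup>2 * (- (3 * (?m (u t))\<^sup>2 * (1 / \<delta>))))) (at t)"
        unfolding P_def[abs_def] by (rule DERIV_minus[OF DERIV_chain2[OF m3 dw]])
      then show ?thesis by (simp add: b_def mult_ac)
    qed
    show "(b has_real_derivative b' t) (at t)" for t
      unfolding b_def[abs_def] b'_def by (rule DERIV_cmult[OF DERIV_mult'[OF dw2 du2]])
    show "continuous_on UNIV b'" unfolding b'_def[abs_def] by (intro continuous_intros cu cw)
    show "continuous_on UNIV b" unfolding b_def[abs_def] by (intro continuous_intros cu cw)
    show "b t = 0" if "t \<le> \<alpha>" for t
    proof -
      have "u t \<le> 0" using that \<delta> by (simp add: u_def divide_le_0_iff)
      then show ?thesis by (simp add: b_def)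
    qed
    show "b t = 0" "P t = 0" if "t \<ge> \<beta>" for t using w0[OF that] by (simp_all add: b_def P_def)
    show "0 \<le> b t" for t using \<delta> by (simp add: b_def)
    show "0 < b t" if "\<alpha> < t" "t < \<beta>" for t
    proof -
      have u: "0 < u t" "u t < 1" using that \<delta> by (auto simp: u_def \<delta>_def field_simps)
      then have "(u t) ^ 3 < 1" by (simp add: power_less_one_iff)
      then have "0 < w t" using u by (simp add: w_def)
      then show ?thesis using u \<delta> by (simp add: b_def)
    qed
  qed
qed

lemma has_derivative_radial_product:
  fixes L1 L2 :: "pt \<Rightarrow> complex"
  assumes L: "bounded_linear L1" "bounded_linear L2"
    and p: "\<And>t. (p has_real_derivative p' t) (at t)" and q: "\<And>t. (q has_real_derivative q' t) (at t)"
  shows "((\<lambda>x. complex_of_real (p ((cmod (L1 x - c1))\<^sup>2) * q ((cmod (L2 x - c2))\<^sup>2))) has_derivative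
    (\<lambda>h. of_real (p ((cmod (L1 x - c1))\<^sup>2) * (q' ((cmod (L2 x - c2))\<^sup>2) * (2 * ((L2 x - c2) \<bullet> L2 h)))
       + p' ((cmod (L1 x - c1))\<^sup>2) * (2 * ((L1 x - c1) \<bullet> L1 h)) * q ((cmod (L2 x - c2))\<^sup>2)))) (at x)"
proof -
  have s: "((\<lambda>x. (cmod (L x - c))\<^sup>2) has_derivative (\<lambda>h. 2 * ((L x - c) \<bullet> L h))) (at x)"
    if "bounded_linear L" for L :: "pt \<Rightarrow> complex" and c
  proof -
    have d: "((\<lambda>x. L x - c) has_derivative L) (at x)"
      using has_derivative_diff[OF bounded_linear_imp_has_derivative[OF that] has_derivative_const] by simp
    have "((\<lambda>x. (L x - c) \<bullet> (L x - c)) has_derivative (\<lambda>h. (L x - c) \<bullet> L h + L h \<bullet> (L x - c))) (at x)"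
      by (rule has_derivative_inner[OF d d])
    then show ?thesis by (simp add: power2_norm_eq_inner inner_commute)
  qed
  have c: "((\<lambda>x. r ((cmod (L x - c))\<^sup>2)) has_derivative (\<lambda>h. r' ((cmod (L x - c))\<^sup>2) * (2 * ((L x - c) \<bullet> L h)))) (at x)"
    if "bounded_linear L" "\<And>t. (r has_real_derivative r' t) (at t)" for L :: "pt \<Rightarrow> complex" and c r r'
    by (rule has_derivative_compose[OF s[OF that(1)] that(2)[unfolded has_field_derivative_def]])
  show ?thesis
    by (rule bounded_linear.has_derivative[OF bounded_linear_of_real
          has_derivative_mult[OF c[OF L(1) p] c[OF L(2) q]]])
qed

text \<open>The conjugate derivative of |z|^2 is z, hence that of p(|z|^2) is z p'(|z|^2); the
  factor depending on the other variable is inert.\<close>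

lemma dbar_radial_product:
  fixes c1 c2 :: complex
  assumes p: "\<And>t. (p has_real_derivative p' t) (at t)" and q: "\<And>t. (q has_real_derivative q' t) (at t)"
  defines "\<phi> \<equiv> \<lambda>x. complex_of_real (p ((cmod (zeta1 x - c1))\<^sup>2) * q ((cmod (zeta2 x - c2))\<^sup>2))"
  shows "dbar 1 \<phi> x = (zeta1 x - c1) * of_real (p' ((cmod (zeta1 x - c1))\<^sup>2) * q ((cmod (zeta2 x - c2))\<^sup>2))"
    "dbar 2 \<phi> x = (zeta2 x - c2) * of_real (p ((cmod (zeta1 x - c1))\<^sup>2) * q' ((cmod (zeta2 x - c2))\<^sup>2))"
proof -
  note P = partial_eq[OF has_derivative_radial_product[OF bounded_linear_zeta1 bounded_linear_zeta2 p q]]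
  have z: "zeta1 (axis 1 1) = 1" "zeta1 (axis 2 1) = \<i>" "zeta1 (axis 3 1) = 0" "zeta1 (axis 0 1) = 0" "zeta1 (axis 4 1) = 0"
    "zeta2 (axis 1 1) = 0" "zeta2 (axis 2 1) = 0" "zeta2 (axis 3 1) = 1" "zeta2 (axis 0 1) = \<i>" "zeta2 (axis 4 1) = \<i>"
    by (auto simp: zeta1_def zeta2_def axis_def complex_eq_iff)
  have i: "w \<bullet> 1 = Re w" "w \<bullet> \<i> = Im w" for w by (simp_all add: inner_complex_def)
  show "dbar 1 \<phi> x = (zeta1 x - c1) * of_real (p' ((cmod (zeta1 x - c1))\<^sup>2) * q ((cmod (zeta2 x - c2))\<^sup>2))"
    unfolding dbar_def \<phi>_def P by (simp add: z i complex_eq_iff)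
  show "dbar 2 \<phi> x = (zeta2 x - c2) * of_real (p ((cmod (zeta1 x - c1))\<^sup>2) * q' ((cmod (zeta2 x - c2))\<^sup>2))"
    unfolding dbar_def \<phi>_def P by (simp add: z i complex_eq_iff)
qed

section \<open>Compactness and enlargement of polydiscs\<close>

lemma norm_le_zeta: "norm x \<le> 2 * cmod (zeta1 x) + 2 * cmod (zeta2 x)"
proof -
  have "norm x \<le> (\<Sum>i\<in>UNIV. \<bar>x $ i\<bar>)" by (rule norm_le_l1_cart)
  also have "\<dots> = \<bar>x $ 1\<bar> + \<bar>x $ 2\<bar> + \<bar>x $ 3\<bar> + \<bar>x $ 4\<bar>" by (simp add: sum_4)
  also have "\<dots> \<le> 2 * cmod (zeta1 x) + 2 * cmod (zeta2 x)"
    using abs_Re_le_cmod[of "zeta1 x"] abs_Im_le_cmod[of "zeta1 x"]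
      abs_Re_le_cmod[of "zeta2 x"] abs_Im_le_cmod[of "zeta2 x"] by (simp add: zeta1_def zeta2_def)
  finally show ?thesis .
qed

lemma continuous_on_zeta [continuous_intros]: "continuous_on S zeta1" "continuous_on S zeta2"
  using linear_continuous_on bounded_linear_zeta1 bounded_linear_zeta2 by blast+

lemma compact_polydisc: "compact (polydisc a1 a2 r1 r2)"
proof -
  have "closed (polydisc a1 a2 r1 r2)"
    unfolding polydisc_def by (intro closed_Collect_conj closed_Collect_le continuous_intros)
  moreover have "bounded (polydisc a1 a2 r1 r2)"
  proof (rule boundedI[of _ "2 * (r1 + cmod a1) + 2 * (r2 + cmod a2)"])
    fix x assume "x \<in> polydisc a1 a2 r1 r2"
    then have "cmod (zeta1 x) \<le> r1 + cmod a1" "cmod (zeta2 x) \<le> r2 + cmod a2"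
      using norm_triangle_sub[of "zeta1 x" a1] norm_triangle_sub[of "zeta2 x" a2] by (auto simp: polydisc_def)
    then have "2 * cmod (zeta1 x) + 2 * cmod (zeta2 x) \<le> 2 * (r1 + cmod a1) + 2 * (r2 + cmod a2)"
      by (intro add_mono mult_left_mono) auto
    then show "norm x \<le> 2 * (r1 + cmod a1) + 2 * (r2 + cmod a2)" by (rule order_trans[OF norm_le_zeta])
  qed
  ultimately show ?thesis by (simp add: compact_eq_bounded_closed)
qed

text \<open>\<open>?m\<close> measures by how much a point exceeds the radii: it is positive off the
  polydisc and attains a positive minimum on the compact set \<open>?K\<close> of nearby points
  outside \<open>U\<close>. Any smaller enlargement avoids that set.\<close>

lemma polydisc_enlarge:
  assumes "open U" "polydisc a1 a2 r1 r2 \<subseteq> U"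
  obtains R1 R2 where "R1 > r1" "R2 > r2" "polydisc a1 a2 R1 R2 \<subseteq> U"
proof -
  let ?K = "polydisc a1 a2 (r1 + 1) (r2 + 1) - U"
  let ?m = "\<lambda>x. max (cmod (zeta1 x - a1) - r1) (cmod (zeta2 x - a2) - r2)"
  show thesis
  proof (cases "?K = {}")
    case True
    then show thesis by (intro that[of "r1 + 1" "r2 + 1"]) auto
  next
    case False
    have "compact ?K" using compact_diff[OF compact_polydisc assms(1)] .
    moreover have "continuous_on ?K ?m" by (intro continuous_intros)
    ultimately obtain x0 where x0: "x0 \<in> ?K" "\<And>x. x \<in> ?K \<Longrightarrow> ?m x0 \<le> ?m x"
      using continuous_attains_inf[of ?K ?m] False by blast
    have "x0 \<notin> polydisc a1 a2 r1 r2" using x0(1) assms(2) by blast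
    then have pos: "?m x0 > 0" by (auto simp: polydisc_def less_max_iff_disj)
    define M where "M = ?m x0"
    \<comment> \<open>The 1 keeps the enlarged polydisc inside the one used for \<open>?K\<close>;
      the half makes the bound strictly smaller than the minimum.\<close>
    define e where "e = min 1 (M / 2)"
    have e: "0 < e" "e \<le> 1" "e < ?m x0" using pos unfolding M_def[symmetric] by (auto simp: e_def min_def)
    show thesis
    proof (rule that[of "r1 + e" "r2 + e"])
      show "r1 + e > r1" "r2 + e > r2" using e(1) by simp_all
      show "polydisc a1 a2 (r1 + e) (r2 + e) \<subseteq> U"
      proof (rule ccontr)
        assume "\<not> ?thesis"
        then obtain x where x: "x \<in> polydisc a1 a2 (r1 + e) (r2 + e)" "x \<notin> U" by blast
        then have "x \<in> ?K" using e(2) by (auto simp: polydisc_def)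
        then have "?m x0 \<le> ?m x" by (rule x0(2))
        moreover have "?m x \<le> e" using x(1) by (simp add: polydisc_def)
        ultimately show False using e(3) by linarith
      qed
    qed
  qed
qed

section \<open>Failure of regularity on the kernel\<close>

lemma open_nonnull:
  fixes W :: "'a::euclidean_space set"
  assumes "open W" "AE x in lebesgue. x \<notin> W" shows "W = {}"
proof -
  have "W \<in> sets lebesgue" using assms(1) by simp
  then have "W \<in> null_sets lebesgue" using assms(2) by (simp add: AE_iff_null_sets)
  then show ?thesis using open_not_negligible[OF assms(1)] by (auto simp: negligible_iff_null_sets)
qed

context bounded_open
begin

lemma test_fun_radial_product:
  assumes P: "\<And>t. (P has_real_derivative P' t) (at t)" "continuous_on UNIV P'"
    and Q: "\<And>t. (Q has_real_derivative Q' t) (at t)" "continuous_on UNIV Q'"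
    and K: "compact K" "K \<subseteq> V"
      "\<And>x. P ((cmod (zeta1 x - c1))\<^sup>2) \<noteq> 0 \<Longrightarrow> Q ((cmod (zeta2 x - c2))\<^sup>2) \<noteq> 0 \<Longrightarrow> x \<in> K"
  shows "test_fun V (\<lambda>x. complex_of_real (P ((cmod (zeta1 x - c1))\<^sup>2) * Q ((cmod (zeta2 x - c2))\<^sup>2)))"
proof (rule test_funI[OF _ K(1,2)])
  have "C1_on V (\<lambda>x. P ((cmod (zeta1 x - c1))\<^sup>2))"
    by (rule C1_on_real_compose[OF C1_on_cmod_sq[OF C1_on_zeta(1)] P(1) continuous_on_subset[OF P(2)]]) simp
  moreover have "C1_on V (\<lambda>x. Q ((cmod (zeta2 x - c2))\<^sup>2))"
    by (rule C1_on_real_compose[OF C1_on_cmod_sq[OF C1_on_zeta(2)] Q(1) continuous_on_subset[OF Q(2)]]) simp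
  ultimately show "C1_on V (\<lambda>x. complex_of_real (P ((cmod (zeta1 x - c1))\<^sup>2) * Q ((cmod (zeta2 x - c2))\<^sup>2)))"
    by (intro C1_on_of_real C1_on_mult)
  show "x \<in> K" if "complex_of_real (P ((cmod (zeta1 x - c1))\<^sup>2) * Q ((cmod (zeta2 x - c2))\<^sup>2)) \<noteq> 0" for x
    using that by (intro K(3)) auto
qed

lemma one_notin_holomorphic_ideal:
  assumes V: "V = U - polydisc a1 a2 r1 r2" and r: "0 < r1" "0 < r2" "r1 < R1" "r2 < R2"
    and R: "polydisc a1 a2 R1 R2 \<subseteq> U"
    and f: "W12 V f1" "W12 V f2"
    and hol: "AE x in lebesgue. x \<in> V \<longrightarrow> dzbar V 1 f1 x = 0" "AE x in lebesgue. x \<in> V \<longrightarrow> dzbar V 2 f2 x = 0"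
    and one: "AE x in lebesgue. x \<in> V \<longrightarrow> (zeta1 x - a1) * f1 x + (zeta2 x - a2) * f2 x = 1"
  shows False
proof -
  \<comment> \<open>The inner radii lie strictly beyond r1 and r2, so that the supports stay at a
    positive distance from the removed closed polydisc and are compact in \<open>V\<close>.\<close>
  define \<rho>1 where "\<rho>1 = (r1 + R1) / 2"
  define \<rho>2 where "\<rho>2 = (r2 + R2) / 2"
  have \<rho>: "r1 < \<rho>1" "\<rho>1 < R1" "r2 < \<rho>2" "\<rho>2 < R2" "0 < \<rho>1" "0 < \<rho>2"
    using r by (auto simp: \<rho>1_def \<rho>2_def)
  have sq: "\<rho>1\<^sup>2 < R1\<^sup>2" "\<rho>2\<^sup>2 < R2\<^sup>2" using \<rho> by (auto intro!: power_strict_mono)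
  obtain P1 b1 b1' where b1: "\<And>t. (P1 has_real_derivative b1 t) (at t)" "\<And>t. (b1 has_real_derivative b1' t) (at t)"
    "continuous_on UNIV b1'" "continuous_on UNIV b1" "\<And>t. t \<le> \<rho>1\<^sup>2 \<Longrightarrow> b1 t = 0" "\<And>t. t \<ge> R1\<^sup>2 \<Longrightarrow> b1 t = 0"
    "\<And>t. t \<ge> R1\<^sup>2 \<Longrightarrow> P1 t = 0" "\<And>t. 0 \<le> b1 t" "\<And>t. \<rho>1\<^sup>2 < t \<Longrightarrow> t < R1\<^sup>2 \<Longrightarrow> 0 < b1 t"
    using C1_bump_exists[OF sq(1)] by blast
  obtain P2 b2 b2' where b2: "\<And>t. (P2 has_real_derivative b2 t) (at t)" "\<And>t. (b2 has_real_derivative b2' t) (at t)"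
    "continuous_on UNIV b2'" "continuous_on UNIV b2" "\<And>t. t \<le> \<rho>2\<^sup>2 \<Longrightarrow> b2 t = 0" "\<And>t. t \<ge> R2\<^sup>2 \<Longrightarrow> b2 t = 0"
    "\<And>t. t \<ge> R2\<^sup>2 \<Longrightarrow> P2 t = 0" "\<And>t. 0 \<le> b2 t" "\<And>t. \<rho>2\<^sup>2 < t \<Longrightarrow> t < R2\<^sup>2 \<Longrightarrow> 0 < b2 t"
    using C1_bump_exists[OF sq(2)] by blast
  define s1 where "s1 x = (cmod (zeta1 x - a1))\<^sup>2" for x
  define s2 where "s2 x = (cmod (zeta2 x - a2))\<^sup>2" for x
  have lt: "c < d" if "c\<^sup>2 < d\<^sup>2" "0 \<le> d" for c d :: real
    using that by (rule power_less_imp_less_base)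
  have le1: "cmod (zeta1 x - a1) < R1" if "s1 x < R1\<^sup>2" for x
    using lt[of _ R1] that r unfolding s1_def by auto
  have le2: "cmod (zeta2 x - a2) < R2" if "s2 x < R2\<^sup>2" for x
    using lt[of _ R2] that r unfolding s2_def by auto
  have ge1: "\<rho>1 < cmod (zeta1 x - a1)" if "\<rho>1\<^sup>2 < s1 x" for x
    using lt[of \<rho>1] that unfolding s1_def by auto
  have ge2: "\<rho>2 < cmod (zeta2 x - a2)" if "\<rho>2\<^sup>2 < s2 x" for x
    using lt[of \<rho>2] that unfolding s2_def by auto
  have nz: "\<rho>1\<^sup>2 < s1 x \<and> s1 x < R1\<^sup>2" if "b1 (s1 x) \<noteq> 0" for x
    using that b1(5,6) by (meson not_le)
  have nz2: "\<rho>2\<^sup>2 < s2 x \<and> s2 x < R2\<^sup>2" if "b2 (s2 x) \<noteq> 0" for x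
    using that b2(5,6) by (meson not_le)
  have nP: "s1 x < R1\<^sup>2" if "P1 (s1 x) \<noteq> 0" for x using that b1(7) by (meson not_le)
  have nP2: "s2 x < R2\<^sup>2" if "P2 (s2 x) \<noteq> 0" for x using that b2(7) by (meson not_le)
  \<comment> \<open>P1 does not vanish near the centre of its disc, so the first variable ranges
    over the whole disc; the factor b2 alone keeps the support away from the removed polydisc. In
    \<open>?K2\<close> the roles are exchanged.\<close>
  let ?K1 = "polydisc a1 a2 R1 R2 \<inter> {x. \<rho>2 \<le> cmod (zeta2 x - a2)}"
  let ?K2 = "polydisc a1 a2 R1 R2 \<inter> {x. \<rho>1 \<le> cmod (zeta1 x - a1)}"
  have K1: "compact ?K1" "?K1 \<subseteq> V"
  proof -
    show "compact ?K1" by (intro compact_Int_closed compact_polydisc closed_Collect_le continuous_intros)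
    show "?K1 \<subseteq> V" using R \<rho> by (auto simp: V polydisc_def)
  qed
  have K2: "compact ?K2" "?K2 \<subseteq> V"
  proof -
    show "compact ?K2" by (intro compact_Int_closed compact_polydisc closed_Collect_le continuous_intros)
    show "?K2 \<subseteq> V" using R \<rho> by (auto simp: V polydisc_def)
  qed
  let ?\<phi>1 = "\<lambda>x. complex_of_real (P1 ((cmod (zeta1 x - a1))\<^sup>2) * b2 ((cmod (zeta2 x - a2))\<^sup>2))"
  let ?\<phi>2 = "\<lambda>x. complex_of_real (b1 ((cmod (zeta1 x - a1))\<^sup>2) * P2 ((cmod (zeta2 x - a2))\<^sup>2))"
  have t1: "test_fun V ?\<phi>1"
  proof (rule test_fun_radial_product[OF b1(1,4) b2(2,3) K1])
    fix x assume "P1 ((cmod (zeta1 x - a1))\<^sup>2) \<noteq> 0" "b2 ((cmod (zeta2 x - a2))\<^sup>2) \<noteq> 0"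
    then show "x \<in> ?K1" using le1[OF nP] le2[of x] ge2[of x] nz2[of x]
      by (auto simp: polydisc_def s1_def s2_def less_imp_le)
  qed
  have t2: "test_fun V ?\<phi>2"
  proof (rule test_fun_radial_product[OF b1(2,3) b2(1,4) K2])
    fix x assume "b1 ((cmod (zeta1 x - a1))\<^sup>2) \<noteq> 0" "P2 ((cmod (zeta2 x - a2))\<^sup>2) \<noteq> 0"
    then show "x \<in> ?K2" using le2[OF nP2] le1[of x] ge1[of x] nz[of x]
      by (auto simp: polydisc_def s1_def s2_def less_imp_le)
  qed
  \<comment> \<open>Both test functions are arranged to produce this same weight, so that their
    contributions combine through z_1 f_1 + z_2 f_2 = 1.\<close>
  define G where "G x = b1 (s1 x) * b2 (s2 x)" for x
  have d1: "dbar 1 ?\<phi>1 x = (zeta1 x - a1) * of_real (G x)" for x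
    using dbar_radial_product(1)[OF b1(1) b2(2)] by (simp add: G_def s1_def s2_def)
  have d2: "dbar 2 ?\<phi>2 x = (zeta2 x - a2) * of_real (G x)" for x
    using dbar_radial_product(2)[OF b1(2) b2(1)] by (simp add: G_def s1_def s2_def)
  let ?F1 = "\<lambda>x. f1 x * dbar 1 ?\<phi>1 x" and ?F2 = "\<lambda>x. f2 x * dbar 2 ?\<phi>2 x"
  note I1 = integral_dbar_test_fun_eq_0[OF f(1) hol(1) t1]
  note I2 = integral_dbar_test_fun_eq_0[OF f(2) hol(2) t2]
  have ae: "AE x in lebesgue. indicator V x *\<^sub>R (?F1 x + ?F2 x) = indicator V x *\<^sub>R complex_of_real (G x)"
    using one
  proof eventually_elim
    case (elim x)
    have e: "?F1 x + ?F2 x = ((zeta1 x - a1) * f1 x + (zeta2 x - a2) * f2 x) * of_real (G x)"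
      unfolding d1 d2 by (simp add: algebra_simps)
    show ?case unfolding e using elim by (cases "x \<in> V") simp_all
  qed
  have contG: "continuous_on V (\<lambda>x. complex_of_real (G x))"
    unfolding G_def s1_def s2_def
    by (intro continuous_on_of_real continuous_on_mult continuous_on_compose2[OF b1(4)]
        continuous_on_compose2[OF b2(4)] continuous_intros) auto
  have mG: "(\<lambda>x. indicator V x *\<^sub>R complex_of_real (G x)) \<in> borel_measurable lebesgue"
    using set_borel_measurable_cont[OF contG] by (simp add: set_borel_measurable_def)
  have i12: "integrable lebesgue (\<lambda>x. indicator V x *\<^sub>R (?F1 x + ?F2 x))"
    using set_integral_add(1)[OF I1(2) I2(2)] by (simp add: set_integrable_def)
  have iG: "integrable lebesgue (\<lambda>x. indicator V x *\<^sub>R complex_of_real (G x))"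
    by (rule integrable_cong_AE_imp[OF i12 mG]) (use ae in \<open>auto elim: eventually_mono\<close>)
  have "(\<integral>x. indicator V x *\<^sub>R complex_of_real (G x) \<partial>lebesgue) = (LINT x:V|lebesgue. ?F1 x + ?F2 x)"
    unfolding set_lebesgue_integral_def
    by (rule integral_cong_AE[OF mG borel_measurable_integrable[OF i12]]) (use ae in \<open>auto elim: eventually_mono\<close>)
  also have "\<dots> = 0" using set_integral_add(2)[OF I1(2) I2(2)] I1(1) I2(1) by simp
  finally have z: "(\<integral>x. complex_of_real (indicator V x * G x) \<partial>lebesgue) = 0"
    by (simp add: scaleR_conv_of_real)
  \<comment> \<open>The integral is complex because f_1 and f_2 are; nonnegativity can be used only
    after passing to the real integral of \<open>G\<close>.\<close>
  have iG': "integrable lebesgue (\<lambda>x. complex_of_real (indicator V x * G x))"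
    using iG by (simp add: scaleR_conv_of_real)
  then have iGr: "integrable lebesgue (\<lambda>x. indicator V x * G x)"
    using complex_of_real_integrable_eq by blast
  have "(\<integral>x. indicator V x * G x \<partial>lebesgue) = 0"
    using z by (simp only: integral_complex_of_real of_real_eq_0_iff)
  moreover have "0 \<le> indicator V x * G x" for x using b1(8) b2(8) by (simp add: G_def)
  ultimately have Gz: "AE x in lebesgue. indicator V x * G x = 0"
    using integral_nonneg_eq_0_iff_AE[OF iGr] by simp
  \<comment> \<open>The product of the two open annuli, on which both bumps are strictly
    positive.\<close>
  define W where "W = {x. (\<rho>1\<^sup>2 < s1 x \<and> s1 x < R1\<^sup>2) \<and> (\<rho>2\<^sup>2 < s2 x \<and> s2 x < R2\<^sup>2)}"
  have "open W" unfolding W_def s1_def s2_def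
    by (intro open_Collect_conj open_Collect_less continuous_intros)
  moreover have "AE x in lebesgue. x \<notin> W"
    using Gz
  proof eventually_elim
    case (elim x)
    show ?case
    proof
      assume x: "x \<in> W"
      then have "x \<in> polydisc a1 a2 R1 R2" "x \<notin> polydisc a1 a2 r1 r2"
        using le1[of x] le2[of x] ge1[of x] \<rho>(1) by (auto simp: W_def polydisc_def)
      then have "x \<in> V" using R V by auto
      moreover have "0 < G x" using x b1(9) b2(9) by (simp add: W_def G_def)
      ultimately show False using elim by simp
    qed
  qed
  ultimately have "W = {}" by (rule open_nonnull)
  moreover have "W \<noteq> {}"
  proof -
    \<comment> \<open>A sample point of \<open>W\<close>: the centre shifted in each variable along
      the real direction by a radius halfway through the annulus.\<close>
    define t1 where "t1 = (\<rho>1 + R1) / 2"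
    define t2 where "t2 = (\<rho>2 + R2) / 2"
    define x :: pt where "x = (\<chi> i. if i = 1 then Re a1 + t1 else if i = 2 then Im a1 else if i = 3 then Re a2 + t2 else Im a2)"
    have "zeta1 x - a1 = of_real t1" "zeta2 x - a2 = of_real t2"
      by (auto simp: x_def zeta1_def zeta2_def complex_eq_iff)
    then have "s1 x = t1\<^sup>2" "s2 x = t2\<^sup>2" by (auto simp: s1_def s2_def)
    moreover have "\<rho>1\<^sup>2 < t1\<^sup>2" "t1\<^sup>2 < R1\<^sup>2" "\<rho>2\<^sup>2 < t2\<^sup>2" "t2\<^sup>2 < R2\<^sup>2"
      using \<rho> by (auto simp: t1_def t2_def intro!: power_strict_mono)
    ultimately have "x \<in> W" by (simp add: W_def)
    then show ?thesis by blast
  qed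
  ultimately show False by blast
qed

text \<open>Exactness already fails in degree 0, where every form is a cycle: the element (1, 0) of
  the kernel is not a combination of values of the shifted operators on the kernel.\<close>

lemma not_taylor_regular_X1car:
  assumes V: "V = U - polydisc a1 a2 r1 r2" and r: "0 < r1" "0 < r2" "r1 < R1" "r2 < R2"
    and R: "polydisc a1 a2 R1 R2 \<subseteq> U"
  shows "\<not> taylor_regular Xsc (XZ V) (X1car V) (Aop V) 4 (spec_point a1 a2)"
proof
  assume reg: "taylor_regular Xsc (XZ V) (X1car V) (Aop V) 4 (spec_point a1 a2)"
  let ?u = "((\<lambda>_. 1), (\<lambda>_. 0)) :: xel"
  have "?u \<in> Xcar V" using W12_const L2_zero by (simp add: Xcar_iff)
  moreover have "XZ V (Aop V 2 ?u)" "XZ V (Aop V 3 ?u)"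
    using dzbar_zero_AE[of _ 1] by (auto simp: Aop_def XZ_def)
  ultimately have u: "?u \<in> X1car V" by (simp add: X1car_def)
  have "\<exists>\<eta>. (\<forall>K. K \<subseteq> {..<4} \<and> card K = Suc 0 \<longrightarrow> \<eta> K \<in> X1car V) \<and>
     (\<forall>J. J \<subseteq> {..<4} \<and> card J = 0 \<longrightarrow> XZ V (koszul_d Xsc (Aop V) 4 (spec_point a1 a2) \<eta> J - ?u))"
    using reg[unfolded taylor_regular_def, rule_format, of 0 "\<lambda>_. ?u"] u by simp
  then obtain \<eta> where \<eta>: "\<And>K. K \<subseteq> {..<4} \<Longrightarrow> card K = Suc 0 \<Longrightarrow> \<eta> K \<in> X1car V"
    "XZ V (koszul_d Xsc (Aop V) 4 (spec_point a1 a2) \<eta> {} - ?u)" by (meson card.empty empty_subsetI)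
  let ?f1 = "fst (\<eta> {0})" and ?f2 = "fst (\<eta> {1})"
  have m: "\<eta> {0} \<in> X1car V" "\<eta> {1} \<in> X1car V" using \<eta>(1) by auto
  have f: "W12 V ?f1" "W12 V ?f2" using m by (auto simp: X1car_def Xcar_iff)
  have hol: "AE x in lebesgue. x \<in> V \<longrightarrow> dzbar V 1 ?f1 x = 0" "AE x in lebesgue. x \<in> V \<longrightarrow> dzbar V 2 ?f2 x = 0"
    using m by (auto simp: X1car_def XZ_def Aop_def)
  have set4: "{i. i < (4::nat) \<and> i \<notin> {}} = {0, 1, 2, 3}" by auto
  have k: "koszul_d Xsc (Aop V) 4 (spec_point a1 a2) \<eta> {} =
     (Aop V 0 (\<eta> {0}) - Xsc a1 (\<eta> {0})) + (Aop V 1 (\<eta> {1}) - Xsc a2 (\<eta> {1}))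
     + (Aop V 2 (\<eta> {2}) - Xsc 0 (\<eta> {2})) + (Aop V 3 (\<eta> {3}) - Xsc 0 (\<eta> {3}))"
    unfolding koszul_d_def set4 by (simp add: spec_point_def add.assoc)
  \<comment> \<open>Only first components are compared. The terms with index 2 and 3 drop out,
    because the Cauchy-Riemann operators have first component 0 and their shift is 0.\<close>
  have "AE x in lebesgue. x \<in> V \<longrightarrow> (zeta1 x - a1) * ?f1 x + (zeta2 x - a2) * ?f2 x = 1"
    using \<eta>(2) unfolding XZ_def k
    by (rule eventually_mono) (auto simp: Aop_def Xsc_def algebra_simps)
  then show False by (rule one_notin_holomorphic_ideal[OF V r R f hol])
qed

end

theorem mainTheorem1:
  fixes a1 a2 :: complex and r1 r2 :: real and U :: "(real^4) set"
  assumes "r1 > 0" and "r2 > 0"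
    and "0 \<in> polydisc a1 a2 r1 r2"
    and "open U" and "bounded U" and "polydisc a1 a2 r1 r2 \<subseteq> U"
  shows "let V = U - polydisc a1 a2 r1 r2 in
           (\<forall>i<4. bounded_op Xsc (XZ V) (Xnorm V) (Xcar V) (Aop V i)) \<and>
           commuting_tuple (XZ V) (Xcar V) (Aop V) 4 \<and>
           hyperinvariant Xsc (XZ V) (Xnorm V) (Xcar V) (Aop V) 4 (X1car V) \<and>
           \<not> (taylor_spectrum Xsc (XZ V) (X1car V) (Aop V) 4
                \<subseteq> taylor_spectrum Xsc (XZ V) (Xcar V) (Aop V) 4)"
proof -
  define V where "V = U - polydisc a1 a2 r1 r2"
  interpret bounded_open V
  proof
    show "open V" unfolding V_def
      by (rule open_Diff[OF \<open>open U\<close> compact_imp_closed[OF compact_polydisc]])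
    show "bounded V" unfolding V_def by (rule bounded_subset[OF \<open>bounded U\<close> Diff_subset])
  qed
  obtain R1 R2 where R: "R1 > r1" "R2 > r2" "polydisc a1 a2 R1 R2 \<subseteq> U"
    using polydisc_enlarge[OF assms(4,6)] .
  have "zeta1 x \<noteq> a1 \<or> zeta2 x \<noteq> a2" if "x \<in> closure V" for x
  proof (rule ccontr)
    assume eq: "\<not> (zeta1 x \<noteq> a1 \<or> zeta2 x \<noteq> a2)"
    \<comment> \<open>Positive radii make the centre an interior point of the polydisc, so this open
      neighbourhood of it misses \<open>V\<close>.\<close>
    let ?O = "{x. cmod (zeta1 x - a1) < r1 \<and> cmod (zeta2 x - a2) < r2}"
    have "open ?O" by (intro open_Collect_conj open_Collect_less continuous_intros)
    moreover have "?O \<inter> V = {}" by (auto simp: V_def polydisc_def)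
    ultimately have "?O \<inter> closure V = {}" by (simp add: open_Int_closure_eq_empty)
    moreover have "x \<in> ?O" using eq assms(1,2) by simp
    ultimately show False using that by blast
  qed
  then have "taylor_regular Xsc (XZ V) (Xcar V) (Aop V) 4 (spec_point a1 a2)"
    by (rule taylor_regular_off_closure)
  moreover have "\<not> taylor_regular Xsc (XZ V) (X1car V) (Aop V) 4 (spec_point a1 a2)"
    by (rule not_taylor_regular_X1car[OF V_def assms(1,2) R])
  moreover have "\<forall>i\<ge>4. spec_point a1 a2 i = 0" by (simp add: spec_point_def)
  ultimately have "spec_point a1 a2 \<in> taylor_spectrum Xsc (XZ V) (X1car V) (Aop V) 4"
    "spec_point a1 a2 \<notin> taylor_spectrum Xsc (XZ V) (Xcar V) (Aop V) 4"
    unfolding taylor_spectrum_def by auto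
  then have "\<not> (taylor_spectrum Xsc (XZ V) (X1car V) (Aop V) 4
      \<subseteq> taylor_spectrum Xsc (XZ V) (Xcar V) (Aop V) 4)" by blast
  then show ?thesis
    unfolding Let_def V_def[symmetric]
    using bounded_op_Aop commuting_tuple_Aop hyperinvariant_X1car by blast
qed

end
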